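(* Let $\mathbb{K}\in\{\mathbb{R},\mathbb{C}\}$, let $A,E\in\mathbb{K}^{m\times n}$, put $\widetilde{A}=A+E$, and let $k=\operatorname{rank}(A)\ge 1$. Let $I\subset\{1,\dots,m\}$ and $J\subset\{1,\dots,n\}$, and put $C=A(:,J)$, $R=A(I,:)$, $U=A(I,J)$, $\widetilde{C}=\widetilde{A}(:,J)$, $\widetilde{R}=\widetilde{A}(I,:)$, $\widetilde{U}=\widetilde{A}(I,J)$, $E_I=E(I,:)$, $E_J=E(:,J)$, $E_{I,J}=E(I,J)$. Assume $\operatorname{rank}(C)=\operatorname{rank}(U)=\operatorname{rank}(R)=k$. Let $A=W_k\Sigma_kV_k^*$ be a compact SVD of $A$, and let $W_{k,I}=W_k(I,:)$, $V_{k,J}=V_k(J,:)$. Let $\|\cdot\|$ be a normalized, uniformly generated, unitarily invariant, submultiplicative norm, and let $\mu\in[1,3]$ be the pseudoinverse perturbation constant of $\|\cdot\|$ (see context). If $\sigma_k(U)>2\mu\|E_{I,J}\|$, then \begin{align*} \|A-\widetilde{C}\widetilde{U}_k^\dagger\widetilde{R}\| \leq{}& \left(\|W_{k,I}^\dagger\|\|E_I\|+\|V_{k,J}^\dagger\|\|E_J\|+4\|W_{k,I}^\dagger\|\|V_{k,J}^\dagger\|\|E_{I,J}\|\right)+\frac{\|U^\dagger\|}{1-2\mu\|U^\dagger\|_2\|E_{I,J}\|}\times\\ &\left(\|W_{k,I}^\dagger\|\|E_I\|\|E_{I,J}\|+\|V_{k,J}^\dagger\|\|E_J\|\|E_{I,J}\|+\|W_{k,I}^\dagger\|\|V_{k,J}^\dagger\|\|E_{I,J}\|^2+\|E_I\|\|E_J\|\right).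 \end{align*}
   Context: For a matrix $B$ and index sets $I,J$, $B(I,J)$ is the submatrix with rows in $I$ and columns in $J$; $B(I,:)$ keeps all columns and $B(:,J)$ keeps all rows. $B^\dagger$ is the Moore--Penrose pseudoinverse; $\|B\|_2$ is the spectral norm; $\sigma_i(B)$ is the $i$-th singular value in descending order. $B_k$ denotes the truncated SVD of order $k$ of $B$ (best rank-$k$ approximation), and $B_k^\dagger=(B_k)^\dagger$. The compact SVD of a rank-$k$ matrix $A\in\mathbb{K}^{m\times n}$ is $A=W_k\Sigma_kV_k^*$ with $W_k\in\mathbb{K}^{m\times k}$, $V_k\in\mathbb{K}^{n\times k}$ having orthonormal columns and $\Sigma_k$ the $k\times k$ diagonal matrix of the positive singular values in descending order. A "normalized, uniformly generated, unitarily invariant, submultiplicative norm" is a family of norms $\|\cdot\|:\bigcup_{p,q\ge 1}\mathbb{K}^{p\times q}\to\mathbb{R}$ (a norm on each $\mathbb{K}^{p\times q}$) such that: $\|x\|=\|x\|_2$ (Euclidean norm) for every vector $x$ viewed as a matrix (normalized); there is a single symmetric function $\phi$ with $\|B\|=\phi(\sigma_1(B),\dots,\sigma_r(B))$, $r=\operatorname{rank}(B)$, for matrices $B$ of every size (uniformly generated); $\|\cdot\|$ is invariant under left and right multiplication by unitary matrices; and $\|BD\|\le\|B\|\|D\|$ whenever $BD$ is defined. All Schatten $p$-norms, $1\le p\le\infty$, are examples. Pseudoinverse perturbation constant (Stewart): $\mu\in[1,3]$ is a constant depending only on the norm $\|\cdot\|$ such that for all matrices $B,\widetilde{B}$ of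 the same size, $\|B^\dagger-\widetilde{B}^\dagger\|\le\mu\|\widetilde{B}^\dagger\|_2\|B^\dagger\|_2\|\widetilde{B}-B\|$ if $\operatorname{rank}(B)=\operatorname{rank}(\widetilde{B})$, and $\|B^\dagger-\widetilde{B}^\dagger\|\le\mu\max\{\|\widetilde{B}^\dagger\|_2^2,\|B^\dagger\|_2^2\}\|\widetilde{B}-B\|$ otherwise. ($\mu=3$ works for every such norm; $\mu=\sqrt2$ for the Frobenius norm, $\mu=\frac{1+\sqrt5}{2}$ for the spectral norm.) *)

theory Defs
  imports
    "Jordan_Normal_Form.Schur_Decomposition"
    "Jordan_Normal_Form.DL_Rank"
    "Jordan_Normal_Form.DL_Submatrix"
begin

text \<open>
  The ground field is a parameter \<open>K\<close>, either \<open>\<real>\<close> or \<open>UNIV\<close>, both as sets of complex numbers;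
  real matrices are complex matrices with real entries. Indices of vectors and matrices
  start at 0.
\<close>

definition kmats :: "complex set \<Rightarrow> nat \<Rightarrow> nat \<Rightarrow> complex mat set" where
  "kmats K p q = {B \<in> carrier_mat p q. elements_mat B \<subseteq> K}"

definition unitary_mats :: "complex set \<Rightarrow> nat \<Rightarrow> complex mat set" where
  "unitary_mats K p = {P \<in> kmats K p p. mat_adjoint P * P = 1\<^sub>m p \<and> P * mat_adjoint P = 1\<^sub>m p}"

definition mrank :: "complex mat \<Rightarrow> nat" where
  "mrank B = vec_space.rank (dim_row B) B"

text \<open>
  The singular values of a \<open>p \<times> q\<close> matrix \<open>B\<close>, in descending order and with multiplicity: the
  square roots of the \<open>min p q\<close> largest eigenvalues of \<open>B\<^sup>*B\<close>. These eigenvalues are real and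
  nonnegative, so that taking real parts only changes the type.
\<close>

definition sing_vals :: "complex mat \<Rightarrow> real list" where
  "sing_vals B = take (min (dim_row B) (dim_col B))
     (rev (sorted_list_of_multiset
       (image_mset (\<lambda>z. sqrt (Re z)) (proots (char_poly (mat_adjoint B * B))))))"

text \<open>\<open>sing_val B i\<close> is \<open>\<sigma>\<^sub>i(B)\<close>, counted from \<open>i = 1\<close> as usual.\<close>

definition sing_val :: "complex mat \<Rightarrow> nat \<Rightarrow> real" where
  "sing_val B i = (if 1 \<le> i \<and> i \<le> length (sing_vals B) then sing_vals B ! (i - 1) else 0)"

definition spectral_norm :: "complex mat \<Rightarrow> real" where
  "spectral_norm B = sing_val B 1"

text \<open>The Moore--Penrose pseudoinverse, as the unique solution of the four Penrose equations.\<close>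

definition pinv :: "complex mat \<Rightarrow> complex mat" where
  "pinv B = (THE X. X \<in> carrier_mat (dim_col B) (dim_row B) \<and>
     B * X * B = B \<and> X * B * X = X \<and>
     mat_adjoint (B * X) = B * X \<and> mat_adjoint (X * B) = X * B)"

definition compact_svd ::
  "complex set \<Rightarrow> complex mat \<Rightarrow> complex mat \<Rightarrow> complex mat \<Rightarrow> complex mat \<Rightarrow> bool" where
  "compact_svd K A W S V \<longleftrightarrow> (let k = mrank A in
     W \<in> kmats K (dim_row A) k \<and> V \<in> kmats K (dim_col A) k \<and>
     mat_adjoint W * W = 1\<^sub>m k \<and> mat_adjoint V * V = 1\<^sub>m k \<and>
     S = mat_diag k (\<lambda>i. complex_of_real (sing_val A (Suc i))) \<and>
     A = W * S * mat_adjoint V)"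

text \<open>The rectangular diagonal factor of a full SVD of \<open>B\<close>, with only the first \<open>t\<close> singular
  values retained.\<close>

definition sigma_mat :: "complex mat \<Rightarrow> nat \<Rightarrow> complex mat" where
  "sigma_mat B t = mat (dim_row B) (dim_col B)
     (\<lambda>(i, j). if i = j \<and> i < t then complex_of_real (sing_val B (Suc i)) else 0)"

definition svd :: "complex set \<Rightarrow> complex mat \<Rightarrow> complex mat \<Rightarrow> complex mat \<Rightarrow> bool" where
  "svd K B W V \<longleftrightarrow> W \<in> unitary_mats K (dim_row B) \<and> V \<in> unitary_mats K (dim_col B) \<and>
     B = W * sigma_mat B (min (dim_row B) (dim_col B)) * mat_adjoint V"

text \<open>
  \<open>truncated_svd K t B X\<close>: the matrix \<open>X\<close> is a truncated SVD of order \<open>t\<close> of \<open>B\<close>. This is a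
  relation because \<open>X\<close> may depend on the chosen SVD if \<open>\<sigma>\<^sub>t(B) = \<sigma>\<^sub>t\<^sub>+\<^sub>1(B)\<close>.
\<close>

definition truncated_svd :: "complex set \<Rightarrow> nat \<Rightarrow> complex mat \<Rightarrow> complex mat \<Rightarrow> bool" where
  "truncated_svd K t B X \<longleftrightarrow> (\<exists>W V. svd K B W V \<and> X = W * sigma_mat B t * mat_adjoint V)"

text \<open>
  A normalized, uniformly generated, unitarily invariant, submultiplicative family of norms on
  the nonempty matrices over \<open>K\<close>. The function \<open>\<phi>\<close> takes lists of any length, and is symmetric in
  its entries; one \<open>\<phi>\<close> serves all matrix sizes.
\<close>

locale uniform_norm =
  fixes K :: "complex set" and nrm :: "complex mat \<Rightarrow> real"
  assumes definite: "\<lbrakk>1 \<le> p; 1 \<le> q; B \<in> kmats K p q\<rbrakk> \<Longrightarrow> nrm B = 0 \<longleftrightarrow> B = 0\<^sub>m p q"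
    and nonneg: "\<lbrakk>1 \<le> p; 1 \<le> q; B \<in> kmats K p q\<rbrakk> \<Longrightarrow> 0 \<le> nrm B"
    and homogeneous: "\<lbrakk>1 \<le> p; 1 \<le> q; B \<in> kmats K p q; c \<in> K\<rbrakk> \<Longrightarrow> nrm (c \<cdot>\<^sub>m B) = cmod c * nrm B"
    and triangle: "\<lbrakk>1 \<le> p; 1 \<le> q; B \<in> kmats K p q; D \<in> kmats K p q\<rbrakk> \<Longrightarrow>
      nrm (B + D) \<le> nrm B + nrm D"
    and normalized: "\<lbrakk>1 \<le> p; x \<in> kmats K p 1\<rbrakk> \<Longrightarrow>
      nrm x = sqrt (\<Sum>i<p. (cmod (x $$ (i, 0)))\<^sup>2)"
    and uniformly_generated: "\<exists>\<phi> :: real list \<Rightarrow> real.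
      (\<forall>xs ys. mset xs = mset ys \<longrightarrow> \<phi> xs = \<phi> ys) \<and>
      (\<forall>p q B. 1 \<le> p \<longrightarrow> 1 \<le> q \<longrightarrow> B \<in> kmats K p q \<longrightarrow>
        nrm B = \<phi> (map (sing_val B) [1..<Suc (mrank B)]))"
    and unitarily_invariant:
      "\<lbrakk>1 \<le> p; 1 \<le> q; B \<in> kmats K p q; P \<in> unitary_mats K p; Q \<in> unitary_mats K q\<rbrakk> \<Longrightarrow>
      nrm (P * B * Q) = nrm B"
    and submultiplicative:
      "\<lbrakk>1 \<le> p; 1 \<le> q; 1 \<le> r; B \<in> kmats K p q; D \<in> kmats K q r\<rbrakk> \<Longrightarrow>
      nrm (B * D) \<le> nrm B * nrm D"

definition pinv_perturbation_const ::
  "complex set \<Rightarrow> (complex mat \<Rightarrow> real) \<Rightarrow> real \<Rightarrow> bool" where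
  "pinv_perturbation_const K nrm \<mu> \<longleftrightarrow> 1 \<le> \<mu> \<and> \<mu> \<le> 3 \<and>
    (\<forall>p q B B'. 1 \<le> p \<longrightarrow> 1 \<le> q \<longrightarrow> B \<in> kmats K p q \<longrightarrow> B' \<in> kmats K p q \<longrightarrow>
      nrm (pinv B - pinv B') \<le>
        (if mrank B = mrank B'
         then \<mu> * spectral_norm (pinv B') * spectral_norm (pinv B) * nrm (B' - B)
         else \<mu> * max ((spectral_norm (pinv B'))\<^sup>2) ((spectral_norm (pinv B))\<^sup>2) * nrm (B' - B)))"

end

theory Submission
  imports Defs
begin

text \<open>
  Since \<open>U\<close> has the rank of \<open>A\<close>, the factor \<open>W\<^sub>I\<close> of \<open>U = W\<^sub>I S V\<^sub>J\<^sup>*\<close> has full column rank, and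
  so has \<open>V\<^sub>J\<close>. Hence \<open>W\<^sub>I\<^sup>\<dagger> W\<^sub>I = 1\<close> and \<open>V\<^sub>J\<^sup>\<dagger> V\<^sub>J = 1\<close>, and with \<open>P = W W\<^sub>I\<^sup>\<dagger>\<close> and \<open>Q = (V V\<^sub>J\<^sup>\<dagger>)\<^sup>*\<close> one gets
  \<open>C = P U\<close>, \<open>R = U Q\<close> and \<open>A = P U Q\<close>. The norms of \<open>P\<close> and \<open>Q\<close> are those of \<open>W\<^sub>I\<^sup>\<dagger>\<close> and \<open>V\<^sub>J\<^sup>\<dagger>\<close>,
  because an isometry on the left and passage to the adjoint preserve the nonzero singular values.

  Let \<open>Y\<close> be the truncation of order \<open>k\<close> of \<open>B = U + E\<close>, where \<open>E\<close> is the block \<open>E\<^sub>I\<^sub>J\<close>, and let \<open>X = Y\<^sup>\<dagger>\<close>.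
  Then
  \<open>A - C' X R' = P (U - U X U) Q - P (U X) E\<^sub>I - E\<^sub>J (X U) Q - E\<^sub>J X E\<^sub>I\<close>.
  Because \<open>B X = Y X\<close> and \<open>X B = X Y\<close> are orthogonal projections, \<open>U X\<close> and \<open>X U\<close> are projections up to
  \<open>E X\<close> and \<open>X E\<close>, and \<open>U - U X U\<close> is \<open>U - Y\<close> up to \<open>Y X E + E X Y - E X E\<close>. A projection does not increase the
  norm, and \<open>\<parallel>U - Y\<parallel> \<le> \<parallel>B - Y\<parallel> + \<parallel>E\<parallel> \<le> 2 \<parallel>E\<parallel>\<close> by the Eckart--Young--Mirsky inequality. This gives the bound
  with \<open>\<parallel>X\<parallel>\<close> in place of the fraction (theorem \<open>skeleton_perturbation\<close>).

  Finally, \<open>Y\<close> has rank \<open>k\<close>, since otherwise \<open>B\<close> would have rank below \<open>k\<close> at a distance less than \<open>\<sigma>\<^sub>k(U)\<close>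
  from \<open>U\<close>. So the perturbation constant applies to the pair \<open>U\<close>, \<open>Y\<close> of equal rank, and
  \<open>\<parallel>X\<parallel> \<le> \<parallel>U\<^sup>\<dagger>\<parallel> + 2 \<mu> \<parallel>U\<^sup>\<dagger>\<parallel>\<^sub>2 \<parallel>E\<parallel> \<parallel>X\<parallel>\<close> can be solved for \<open>\<parallel>X\<parallel>\<close>; the gap condition and
  \<open>\<sigma>\<^sub>k(U) \<parallel>U\<^sup>\<dagger>\<parallel>\<^sub>2 \<le> 1\<close> make the denominator positive.

  Singular values enter only through a unitary matrix \<open>V\<close> that diagonalizes \<open>B\<^sup>* B\<close>. From it come the
  rank, the pseudoinverse and Weyl's inequality \<open>\<sigma>\<^sub>i\<^sub>+\<^sub>r(M) \<le> \<sigma>\<^sub>i(M - N)\<close> for \<open>rank N \<le> r\<close>. The norm of a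
  matrix equals the norm of the rectangular diagonal matrix of its singular values, which is real. So
  complex spectral theory also serves the real case, and the Mirsky inequality reduces, by Weyl's
  inequality, to monotonicity of the norm on diagonal matrices.
\<close>

section \<open>Adjoints, unitary matrices and the Euclidean norm\<close>

abbreviation adj :: "complex mat \<Rightarrow> complex mat" where
  "adj \<equiv> mat_adjoint"

lemma dim_adj [simp]: "dim_row (adj A) = dim_col A" "dim_col (adj A) = dim_row A"
  by (auto simp: mat_adjoint_def)

lemma adj_carrier [simp]: "A \<in> carrier_mat p q \<Longrightarrow> adj A \<in> carrier_mat q p"
  by (metis carrier_matD carrier_matI dim_adj)

lemma adj_index [simp]:
  "i < dim_col A \<Longrightarrow> j < dim_row A \<Longrightarrow> adj A $$ (i, j) = cnj (A $$ (j, i))"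
  by (simp add: mat_adjoint_def mat_of_rows_def)

lemma adj_adj [simp]: "adj (adj A) = A"
  by (rule eq_matI) auto

lemma mult_index:
  assumes "A \<in> carrier_mat p q" "B \<in> carrier_mat q r" "i < p" "j < r"
  shows "(A * B) $$ (i, j) = (\<Sum>l<q. A $$ (i, l) * B $$ (l, j))"
  using assms by (auto simp: scalar_prod_def lessThan_atLeast0)

lemma mult_vec_index:
  assumes "A \<in> carrier_mat p q" "x \<in> carrier_vec q" "i < p"
  shows "(A *\<^sub>v x) $ i = (\<Sum>l<q. A $$ (i, l) * x $ l)"
  using assms by (auto simp: scalar_prod_def lessThan_atLeast0)

lemma adj_mult:
  assumes A: "A \<in> carrier_mat p q" and B: "B \<in> carrier_mat q r"
  shows "adj (A * B) = adj B * adj A"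
proof (rule eq_matI)
  fix i j assume "i < dim_row (adj B * adj A)" "j < dim_col (adj B * adj A)"
  then have ij: "i < r" "j < p" using A B by auto
  show "adj (A * B) $$ (i, j) = (adj B * adj A) $$ (i, j)"
    using A B ij mult_index[OF A B, of j i] mult_index[OF adj_carrier[OF B] adj_carrier[OF A] ij]
    by (auto simp: mult.commute intro!: sum.cong)
qed (use A B in auto)

text \<open>Product laws whose side conditions are equations between dimensions, so that the simplifier
  can discharge them.\<close>

lemma assoc_mult_mat':
  fixes A :: "'a::semiring_0 mat"
  assumes "dim_col A = dim_row B" "dim_col B = dim_row C"
  shows "A * B * C = A * (B * C)"
  using assms by (intro assoc_mult_mat[of _ "dim_row A" "dim_row B" _ "dim_row C" _ "dim_col C"]) auto

lemma adj_mult': "dim_col A = dim_row B \<Longrightarrow> adj (A * B) = adj B * adj A"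
  by (rule adj_mult[of _ "dim_row A" "dim_row B" _ "dim_col B"]) auto

lemma mult_minus_distrib_mat':
  fixes A :: "complex mat"
  assumes "dim_col A = dim_row B" "dim_row C = dim_row B" "dim_col C = dim_col B"
  shows "A * (B - C) = A * B - A * C"
  using assms by (intro mult_minus_distrib_mat[of _ "dim_row A" "dim_row B" _ "dim_col B"]) auto

lemma minus_mult_distrib_mat':
  fixes A :: "complex mat"
  assumes "dim_row A = dim_row B" "dim_col A = dim_col B" "dim_col A = dim_row C"
  shows "(A - B) * C = A * C - B * C"
  using assms by (intro minus_mult_distrib_mat[of _ "dim_row A" "dim_row C" _ _ "dim_col C"]) auto

lemma add_mult_distrib_mat':
  fixes A :: "complex mat"
  assumes "dim_row A = dim_row B" "dim_col A = dim_col B" "dim_col A = dim_row C"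
  shows "(A + B) * C = A * C + B * C"
  using assms by (intro add_mult_distrib_mat[of _ "dim_row A" "dim_row C" _ _ "dim_col C"]) auto

lemma mult_add_distrib_mat':
  fixes A :: "complex mat"
  assumes "dim_col A = dim_row B" "dim_row C = dim_row B" "dim_col C = dim_col B"
  shows "A * (B + C) = A * B + A * C"
  using assms by (intro mult_add_distrib_mat[of _ "dim_row A" "dim_row B" _ "dim_col B"]) auto

lemma adj_minus:
  assumes "A \<in> carrier_mat p q" "B \<in> carrier_mat p q"
  shows "adj (A - B) = adj A - adj B"
  by (rule eq_matI) (use assms in auto)

lemma adj_one [simp]: "adj (1\<^sub>m n) = 1\<^sub>m n"
  by (rule eq_matI) auto

lemma adj_mat_diag_real [simp]:
  "adj (mat_diag n (\<lambda>i. complex_of_real (d i))) = mat_diag n (\<lambda>i. complex_of_real (d i))"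
  by (rule eq_matI) (auto simp: mat_diag_def)

definition unitary :: "nat \<Rightarrow> complex mat \<Rightarrow> bool" where
  "unitary n V \<longleftrightarrow> V \<in> carrier_mat n n \<and> adj V * V = 1\<^sub>m n \<and> V * adj V = 1\<^sub>m n"

lemma unitaryD:
  assumes "unitary n V"
  shows "V \<in> carrier_mat n n" "adj V \<in> carrier_mat n n" "adj V * V = 1\<^sub>m n" "V * adj V = 1\<^sub>m n"
  using assms by (auto simp: unitary_def)

lemma unitaryI:
  assumes "V \<in> carrier_mat n n" "adj V * V = 1\<^sub>m n"
  shows "unitary n V"
  using mat_mult_left_right_inverse[OF adj_carrier[OF assms(1)] assms] assms
  by (simp add: unitary_def)

lemma unitary_cancel:
  assumes "unitary n V" "dim_row X = n"
  shows "V * (adj V * X) = X" "adj V * (V * X) = X"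
  using assms unitaryD[OF assms(1)] by (simp_all flip: assoc_mult_mat')

lemma unitary_one: "unitary n (1\<^sub>m n)"
  by (rule unitaryI) auto

lemma unitary_mult:
  assumes "unitary n V" "unitary n W"
  shows "unitary n (V * W)"
proof (rule unitaryI)
  note V = unitaryD[OF assms(1)] and W = unitaryD[OF assms(2)]
  show "V * W \<in> carrier_mat n n" using V W by auto
  have "adj (V * W) * (V * W) = adj W * (adj V * (V * W))"
    using V W by (simp add: adj_mult' assoc_mult_mat')
  also have "adj V * (V * W) = W"
    using V W by (simp flip: assoc_mult_mat')
  also have "adj W * W = 1\<^sub>m n" by (rule W)
  finally show "adj (V * W) * (V * W) = 1\<^sub>m n" .
qed

definition sqnorm :: "complex vec \<Rightarrow> real" where
  "sqnorm x = (\<Sum>i<dim_vec x. (cmod (x $ i))\<^sup>2)"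

lemma sqnorm_nonneg: "0 \<le> sqnorm x"
  by (auto simp: sqnorm_def intro: sum_nonneg)

lemma sqnorm_eq_0_iff: "x \<in> carrier_vec n \<Longrightarrow> sqnorm x = 0 \<longleftrightarrow> x = 0\<^sub>v n"
  by (auto simp: sqnorm_def sum_nonneg_eq_0_iff)

text \<open>The Gram matrix \<open>B\<^sup>* B\<close> alone determines the lengths of all vectors \<open>B x\<close>.\<close>

lemma sqnorm_mult_vec:
  assumes B: "B \<in> carrier_mat p q" and x: "x \<in> carrier_vec q"
  shows "complex_of_real (sqnorm (B *\<^sub>v x)) =
    (\<Sum>i<q. \<Sum>j<q. cnj (x $ i) * (adj B * B) $$ (i, j) * x $ j)"
proof -
  have "complex_of_real (sqnorm (B *\<^sub>v x)) = (\<Sum>l<p. cnj ((B *\<^sub>v x) $ l) * (B *\<^sub>v x) $ l)"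
    using B by (auto simp: sqnorm_def complex_norm_square mult.commute
      simp del: of_real_power intro!: sum.cong)
  also have "\<dots> = (\<Sum>l<p. \<Sum>i<q. \<Sum>j<q. cnj (x $ i) * (cnj (B $$ (l, i)) * B $$ (l, j)) * x $ j)"
  proof (rule sum.cong[OF refl])
    fix l assume "l \<in> {..<p}"
    then have l: "l < p" by simp
    show "cnj ((B *\<^sub>v x) $ l) * (B *\<^sub>v x) $ l =
      (\<Sum>i<q. \<Sum>j<q. cnj (x $ i) * (cnj (B $$ (l, i)) * B $$ (l, j)) * x $ j)"
      unfolding mult_vec_index[OF B x l] cnj_sum sum_product complex_cnj_mult
      by (intro sum.cong refl) (simp add: mult_ac)
  qed
  also have "\<dots> = (\<Sum>i<q. \<Sum>l<p. \<Sum>j<q. cnj (x $ i) * (cnj (B $$ (l, i)) * B $$ (l, j)) * x $ j)"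
    by (rule sum.swap)
  also have "\<dots> = (\<Sum>i<q. \<Sum>j<q. \<Sum>l<p. cnj (x $ i) * (cnj (B $$ (l, i)) * B $$ (l, j)) * x $ j)"
    by (rule sum.cong[OF refl]) (rule sum.swap)
  also have "\<dots> = (\<Sum>i<q. \<Sum>j<q. cnj (x $ i) * (adj B * B) $$ (i, j) * x $ j)"
  proof (intro sum.cong refl)
    fix i j assume "i \<in> {..<q}" "j \<in> {..<q}"
    then have "(adj B * B) $$ (i, j) = (\<Sum>l<p. cnj (B $$ (l, i)) * B $$ (l, j))"
      using mult_index[OF adj_carrier[OF B] B, of i j] B by (auto intro!: sum.cong)
    then show "(\<Sum>l<p. cnj (x $ i) * (cnj (B $$ (l, i)) * B $$ (l, j)) * x $ j)
      = cnj (x $ i) * (adj B * B) $$ (i, j) * x $ j"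
      by (simp add: sum_distrib_left sum_distrib_right)
  qed
  finally show ?thesis .
qed

lemma sqnorm_mult_vec_diag:
  assumes B: "B \<in> carrier_mat p q" and x: "x \<in> carrier_vec q"
    and D: "adj B * B = mat_diag q (\<lambda>i. complex_of_real (c i))"
  shows "sqnorm (B *\<^sub>v x) = (\<Sum>i<q. c i * (cmod (x $ i))\<^sup>2)"
proof -
  have "complex_of_real (sqnorm (B *\<^sub>v x)) =
    (\<Sum>i<q. \<Sum>j<q. if j = i then cnj (x $ i) * complex_of_real (c i) * x $ i else 0)"
    unfolding sqnorm_mult_vec[OF B x] D by (intro sum.cong refl) (auto simp: mat_diag_def)
  also have "\<dots> = complex_of_real (\<Sum>i<q. c i * (cmod (x $ i))\<^sup>2)"
    by (simp add: complex_norm_square mult_ac del: of_real_power)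
  finally show ?thesis using of_real_eq_iff by blast
qed

lemma sqnorm_isometry:
  assumes "B \<in> carrier_mat p q" "x \<in> carrier_vec q" "adj B * B = 1\<^sub>m q"
  shows "sqnorm (B *\<^sub>v x) = sqnorm x"
  using sqnorm_mult_vec_diag[of B p q x "\<lambda>_. 1"] assms by (simp add: sqnorm_def)

lemma mat_eq_0_if_adj_mult_self_eq_0:
  assumes B: "B \<in> carrier_mat p q" and 0: "adj B * B = 0\<^sub>m q q"
  shows "B = 0\<^sub>m p q"
proof (rule eq_matI)
  fix i j assume "i < dim_row (0\<^sub>m p q :: complex mat)" "j < dim_col (0\<^sub>m p q :: complex mat)"
  then have ij: "i < p" "j < q" by auto
  have "complex_of_real (sqnorm (B *\<^sub>v unit_vec q j)) = 0"
    using sqnorm_mult_vec[OF B, of "unit_vec q j"] by (simp add: 0)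
  then have "B *\<^sub>v unit_vec q j = 0\<^sub>v p"
    using sqnorm_eq_0_iff[of "B *\<^sub>v unit_vec q j" p] B by auto
  moreover have "(B *\<^sub>v unit_vec q j) $ i = B $$ (i, j)"
    using B ij by simp
  ultimately show "B $$ (i, j) = 0\<^sub>m p q $$ (i, j)" using ij by simp
qed (use B in auto)

section \<open>The spectral theorem\<close>

text \<open>Gram--Schmidt, applied to a basis that starts with \<open>v\<close>, keeps \<open>v\<close> as its first vector; the
  orthogonal vectors it returns are then normalized.\<close>

lemma orthonormal_extension:
  assumes v: "v \<in> carrier_vec n" and v0: "v \<noteq> 0\<^sub>v n"
  obtains W c where "unitary n W" "c \<noteq> 0" "col W 0 = c \<cdot>\<^sub>v v"
proof -
  interpret cof_vec_space n "TYPE(complex)" .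
  from v v0 have n: "0 < n" by (cases n) auto
  define b where "b = basis_completion v"
  define ws where "ws = gram_schmidt n b"
  from basis_completion[OF v v0, folded b_def]
  have b: "distinct b" "\<not> lin_dep (set b)" "set b \<subseteq> carrier_vec n" "hd b = v" "length b = n"
    by auto
  from gram_schmidt_result[OF b(3) b(1) b(2) ws_def]
  have ws: "set ws \<subseteq> carrier_vec n" "corthogonal ws" "length ws = n"
    using b(5) by auto
  from b n obtain vs where "b = v # vs" by (cases b) auto
  then have "hd ws = v" unfolding ws_def using gram_schmidt_hd[OF v] by simp
  then have ws0: "ws ! 0 = v" using ws(3) n by (cases ws) auto
  have wsc: "ws ! j \<in> carrier_vec n" if "j < n" for j using ws that by auto
  define c where "c j = 1 / sqrt (sqnorm (ws ! j))" for j
  have inner: "(\<Sum>l<n. cnj (ws ! i $ l) * ws ! j $ l) = ws ! j \<bullet>c ws ! i" if "i < n" "j < n" for i j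
    using wsc[OF that(1)] wsc[OF that(2)]
    by (auto simp: scalar_prod_def lessThan_atLeast0 mult.commute intro!: sum.cong)
  have pos: "sqnorm (ws ! j) > 0" if "j < n" for j
  proof -
    have "ws ! j \<bullet>c ws ! j \<noteq> 0" using corthogonalD[OF ws(2), of j j] that ws(3) by auto
    then have "ws ! j \<noteq> 0\<^sub>v n" using wsc[OF that] by auto
    then show ?thesis using sqnorm_eq_0_iff[OF wsc[OF that]] sqnorm_nonneg[of "ws ! j"] by linarith
  qed
  define W where "W = mat n n (\<lambda>(i, j). complex_of_real (c j) * ws ! j $ i)"
  have W: "W \<in> carrier_mat n n" by (simp add: W_def)
  have "adj W * W = 1\<^sub>m n"
  proof (rule eq_matI)
    fix i j assume "i < dim_row (1\<^sub>m n :: complex mat)" "j < dim_col (1\<^sub>m n :: complex mat)"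
    then have ij: "i < n" "j < n" by auto
    have "(adj W * W) $$ (i, j) = (\<Sum>l<n. cnj (W $$ (l, i)) * W $$ (l, j))"
      using mult_index[OF adj_carrier[OF W] W ij] W ij by (auto intro!: sum.cong)
    also have "\<dots> = complex_of_real (c i) * complex_of_real (c j) * (\<Sum>l<n. cnj (ws ! i $ l) * ws ! j $ l)"
      using ij unfolding sum_distrib_left by (auto simp: W_def intro!: sum.cong)
    also have "\<dots> = 1\<^sub>m n $$ (i, j)"
    proof (cases "i = j")
      case True
      have "(\<Sum>l<n. cnj (ws ! i $ l) * ws ! i $ l) = complex_of_real (sqnorm (ws ! i))"
        using wsc[OF ij(1)] by (auto simp: sqnorm_def complex_norm_square mult.commute simp del: of_real_power intro!: sum.cong)
      moreover have "c i * c i * sqnorm (ws ! i) = 1"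
        using pos[OF ij(1)] by (simp add: c_def)
      ultimately show ?thesis using True ij by (simp flip: of_real_mult)
    next
      case False
      then have "ws ! j \<bullet>c ws ! i = 0"
        using corthogonalD[OF ws(2), of j i] ij ws(3) by auto
      then show ?thesis using inner[OF ij] False ij by simp
    qed
    finally show "(adj W * W) $$ (i, j) = 1\<^sub>m n $$ (i, j)" .
  qed (use W in auto)
  then have "unitary n W" using W by (rule unitaryI[rotated])
  moreover have "complex_of_real (c 0) \<noteq> 0" using pos[OF n] by (simp add: c_def)
  moreover have "col W 0 = complex_of_real (c 0) \<cdot>\<^sub>v v"
    using n v ws0 by (intro eq_vecI) (auto simp: W_def)
  ultimately show thesis by (rule that)
qed

lemma four_block_11_eq_mat_diag:
  assumes "n = Suc r"
  shows "four_block_mat (mat 1 1 (\<lambda>_. e)) (0\<^sub>m 1 r) (0\<^sub>m r 1) (mat_diag r f) =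
    mat_diag n (\<lambda>i. case i of 0 \<Rightarrow> e | Suc j \<Rightarrow> f j)"
  by (rule eq_matI) (use assms in \<open>auto simp: mat_diag_def split: nat.splits\<close>)

text \<open>Deflation: in an orthonormal basis that starts with an eigenvector, a Hermitian matrix splits off a
  diagonal block of size 1, and the rest is Hermitian with one eigenvalue less. The
  diagonal lists the eigenvalues in any prescribed order \<open>es\<close>.\<close>

theorem hermitian_diagonalization:
  assumes "H \<in> carrier_mat n n" "adj H = H" "char_poly H = (\<Prod>e\<leftarrow>es. [:- e, 1:])"
  shows "\<exists>V. unitary n V \<and> adj V * H * V = mat_diag n (\<lambda>i. es ! i)"
  using assms
proof (induction es arbitrary: n H)
  case Nil
  then have "n = 0" using degree_monic_char_poly[of H n] by simp
  then show ?case using Nil(1) by (intro exI[of _ "1\<^sub>m 0"]) (auto simp: unitary_one mat_diag_def intro!: eq_matI)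
next
  case (Cons e es)
  note H = Cons.prems(1) and herm = Cons.prems(2) and cp = Cons.prems(3)
  have ev: "eigenvalue H e"
    unfolding eigenvalue_root_char_poly[OF H] cp by simp
  then obtain v where v: "v \<in> carrier_vec n" "v \<noteq> 0\<^sub>v n" and Hv: "H *\<^sub>v v = e \<cdot>\<^sub>v v"
    using H by (auto simp: eigenvalue_def eigenvector_def)
  obtain r where n: "n = Suc r" using v by (cases n) auto
  obtain W c where W: "unitary n W" and c: "c \<noteq> 0" and W0: "col W 0 = c \<cdot>\<^sub>v v"
    by (rule orthonormal_extension[OF v])
  note Wc = unitaryD[OF W]
  define H' where "H' = adj W * (H * W)"
  have H': "H' \<in> carrier_mat n n" using H Wc by (intro carrier_matI) (auto simp: H'_def)
  have herm': "adj H' = H'"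
    using H Wc herm by (simp add: H'_def adj_mult' assoc_mult_mat')
  have HW0: "(H * W) $$ (l, 0) = e * W $$ (l, 0)" if "l < n" for l
  proof -
    have "(H * W) $$ (l, 0) = (H *\<^sub>v col W 0) $ l"
      using H Wc n that by simp
    also have "H *\<^sub>v col W 0 = e \<cdot>\<^sub>v col W 0"
      unfolding W0 using H v Hv by (simp add: mult_mat_vec smult_smult_assoc mult.commute)
    finally show ?thesis using Wc n that by simp
  qed
  have col0: "H' $$ (i, 0) = (if i = 0 then e else 0)" if i: "i < n" for i
  proof -
    have "H' $$ (i, 0) = (\<Sum>l<n. adj W $$ (i, l) * (H * W) $$ (l, 0))"
      unfolding H'_def using H Wc i n by (intro mult_index) auto
    also have "\<dots> = e * (\<Sum>l<n. adj W $$ (i, l) * W $$ (l, 0))"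
      by (simp add: HW0 sum_distrib_left mult_ac)
    also have "(\<Sum>l<n. adj W $$ (i, l) * W $$ (l, 0)) = (adj W * W) $$ (i, 0)"
      using Wc(1) i n by (intro mult_index[symmetric]) auto
    finally show ?thesis using Wc i n by auto
  qed
  have row0: "H' $$ (0, i) = (if i = 0 then e else 0)" if i: "i < n" for i
  proof (cases "i = 0")
    case True
    then show ?thesis using col0[of 0] n by simp
  next
    case False
    have "adj H' $$ (0, i) = cnj (H' $$ (i, 0))" using H' i n by simp
    then show ?thesis using col0[OF i] False by (simp add: herm')
  qed
  define H3 where "H3 = mat r r (\<lambda>(i, j). H' $$ (Suc i, Suc j))"
  have H3: "H3 \<in> carrier_mat r r" by (simp add: H3_def)
  have H'_block: "H' = four_block_mat (mat 1 1 (\<lambda>_. e)) (0\<^sub>m 1 r) (0\<^sub>m r 1) H3"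
  proof (rule eq_matI)
    fix i j assume "i < dim_row (four_block_mat (mat 1 1 (\<lambda>_. e)) (0\<^sub>m 1 r) (0\<^sub>m r 1) H3)"
      "j < dim_col (four_block_mat (mat 1 1 (\<lambda>_. e)) (0\<^sub>m 1 r) (0\<^sub>m r 1) H3)"
    then have "i < n" "j < n" using H3 n by auto
    then show "H' $$ (i, j) = four_block_mat (mat 1 1 (\<lambda>_. e)) (0\<^sub>m 1 r) (0\<^sub>m r 1) H3 $$ (i, j)"
      using n H3 row0[of j] col0[of i] by (cases i; cases j) (auto simp: H3_def)
  qed (use H3 H' n in auto)
  have herm3: "adj H3 = H3"
  proof (rule eq_matI)
    fix i j assume "i < dim_row H3" "j < dim_col H3"
    then have ij: "i < r" "j < r" using H3 by auto
    have "adj H' $$ (Suc i, Suc j) = cnj (H' $$ (Suc j, Suc i))" using H' ij n by simp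
    then show "adj H3 $$ (i, j) = H3 $$ (i, j)" using ij by (simp add: H3_def herm')
  qed (use H3 in auto)
  have "similar_mat H' H"
    unfolding similar_mat_def
    by (intro exI[of _ "adj W"] exI[of _ W] similar_mat_witI[of _ _ n])
       (use H H' Wc in \<open>auto simp: H'_def assoc_mult_mat'\<close>)
  then have "char_poly H' = char_poly H" by (rule char_poly_similar)
  moreover have "char_poly H' = char_poly (mat 1 1 (\<lambda>_. e)) * char_poly H3"
    unfolding H'_block by (rule char_poly_four_block_zeros_col) (use H3 in auto)
  moreover have "char_poly (mat 1 1 (\<lambda>_. e)) = [:- e, 1:]"
    by (simp add: char_poly_defs det_def sign_def)
  ultimately have "[:- e, 1:] * char_poly H3 = [:- e, 1:] * (\<Prod>e\<leftarrow>es. [:- e, 1:])"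
    using cp by simp
  then have "char_poly H3 = (\<Prod>e\<leftarrow>es. [:- e, 1:])"
    by (metis mult_cancel_left pCons_eq_0_iff zero_neq_one)
  from Cons.IH[OF H3 herm3 this] obtain V3 where V3: "unitary r V3"
    and V3H: "adj V3 * H3 * V3 = mat_diag r (\<lambda>i. es ! i)" by blast
  note V3c = unitaryD[OF V3]
  define G where "G = four_block_mat (1\<^sub>m 1) (0\<^sub>m 1 r) (0\<^sub>m r 1) V3"
  have G: "G \<in> carrier_mat n n" using V3c n by (auto simp: G_def)
  have adjG: "adj G = four_block_mat (1\<^sub>m 1) (0\<^sub>m 1 r) (0\<^sub>m r 1) (adj V3)"
    by (rule eq_matI) (use V3c n in \<open>auto simp: G_def\<close>)
  have one_four: "four_block_mat (1\<^sub>m 1) (0\<^sub>m 1 r) (0\<^sub>m r 1) (1\<^sub>m r) = (1\<^sub>m n :: complex mat)"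
    using n by (intro eq_matI) auto
  have "adj G * G = 1\<^sub>m n"
    unfolding adjG unfolding G_def
    using V3c n by (simp add: mult_four_block_mat[of _ 1 1 _ r _ r _ _ 1 _ r] one_four)
  then have uG: "unitary n G" using G by (rule unitaryI[rotated])
  have "adj G * H' * G = four_block_mat (mat 1 1 (\<lambda>_. e)) (0\<^sub>m 1 r) (0\<^sub>m r 1) (adj V3 * H3 * V3)"
    unfolding adjG unfolding G_def H'_block
    using V3c H3 mult_carrier_mat[OF V3c(2) H3]
      mult_carrier_mat[OF mult_carrier_mat[OF V3c(2) H3] V3c(1)]
    by (simp add: mult_four_block_mat[of _ 1 1 _ r _ r _ _ 1 _ r])
  also have "\<dots> = mat_diag n (\<lambda>i. (e # es) ! i)"
    unfolding V3H four_block_11_eq_mat_diag[OF n] by (simp add: nth_Cons)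
  also have "adj G * H' * G = adj (W * G) * H * (W * G)"
    using G Wc H by (simp add: H'_def adj_mult' assoc_mult_mat')
  finally show ?case using unitary_mult[OF W uG] by blast
qed

section \<open>Rank\<close>

text \<open>The columns of \<open>A X\<close> lie in the column space of \<open>A\<close>.\<close>

lemma mrank_mult_le_left:
  assumes A: "A \<in> carrier_mat p q" and X: "X \<in> carrier_mat q r"
  shows "mrank (A * X) \<le> mrank A"
proof -
  interpret vec_space "TYPE(complex)" p .
  have cA: "set (cols A) \<subseteq> carrier_vec p" and cAX: "set (cols (A * X)) \<subseteq> carrier_vec p"
    using A X cols_dim[of A] cols_dim[of "A * X"] by auto
  have "set (cols (A * X)) \<subseteq> span (set (cols A))"
  proof
    fix y assume "y \<in> set (cols (A * X))"
    then obtain j where j: "j < r" "y = col (A * X) j"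
      using X by (auto simp: cols_def)
    then have y: "y = A *\<^sub>v col X j" "col X j \<in> carrier_vec q" using A X by auto
    have "y \<in> col_space A"
      unfolding col_space_eq[OF A] using A y by auto
    then show "y \<in> span (set (cols A))" by (simp add: col_space_def)
  qed
  moreover have sub: "VectorSpace.subspace class_ring (span (set (cols A))) V"
    using cA by (rule span_is_subspace)
  ultimately have "span (set (cols (A * X))) \<subseteq> span (set (cols A))"
    by (simp add: span_is_subset VectorSpace.subspace_def)
  then have "VectorSpace.subspace class_ring (span (set (cols (A * X)))) (vs (span (set (cols A))))"
    using nested_subspaces[OF sub span_is_subspace[OF cAX]] by blast
  then have "rank (A * X) \<le> rank A"
    unfolding rank_def
    using vectorspace.subspace_dim[OF subspace_is_vs[OF sub], of "span (set (cols (A * X)))"]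
      fin_dim_span_cols[OF A] fin_dim_span_cols[OF mult_carrier_mat[OF A X]] by auto
  then show ?thesis using A by (simp add: mrank_def)
qed

lemma mrank_le_dim:
  assumes A: "A \<in> carrier_mat p q"
  shows "mrank A \<le> p" "mrank A \<le> q"
proof -
  interpret vec_space "TYPE(complex)" p .
  have "mrank A \<le> mrank (1\<^sub>m p :: complex mat)"
    using mrank_mult_le_left[of "1\<^sub>m p" p p A q] A by simp
  also have "\<dots> \<le> p" unfolding mrank_def using rank_le_nc[of "1\<^sub>m p" p] by simp
  finally show "mrank A \<le> p" .
  show "mrank A \<le> q" unfolding mrank_def using rank_le_nc[OF A] A by simp
qed

text \<open>Nonzero orthogonal columns are linearly independent, and the remaining columns vanish.\<close>

lemma mrank_orthogonal_cols:
  assumes M: "M \<in> carrier_mat p q"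
    and D: "adj M * M = mat_diag q (\<lambda>i. complex_of_real (c i))"
  shows "mrank M = card {i. i < q \<and> c i \<noteq> 0}"
proof -
  interpret vec_space "TYPE(complex)" p .
  define S where "S = col M ` {i. i < q \<and> c i \<noteq> 0}"
  have gram: "(\<Sum>l<p. cnj (col M i $ l) * col M j $ l) = (if i = j then complex_of_real (c i) else 0)"
    if "i < q" "j < q" for i j
  proof -
    have "(\<Sum>l<p. cnj (col M i $ l) * col M j $ l) = (adj M * M) $$ (i, j)"
      using mult_index[OF adj_carrier[OF M] M that] M that by (auto intro!: sum.cong)
    then show ?thesis using that by (simp add: D mat_diag_def)
  qed
  have cols: "set (cols M) = col M ` {..<q}"
    using M by (auto simp: cols_def)
  have colM: "col M i \<in> carrier_vec p" for i using M by (auto intro: col_carrier_vec)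
  have inj: "inj_on (col M) {i. i < q \<and> c i \<noteq> 0}"
  proof (rule inj_onI, rule ccontr)
    fix i j assume i: "i \<in> {i. i < q \<and> c i \<noteq> 0}" and j: "j \<in> {i. i < q \<and> c i \<noteq> 0}"
      and eq: "col M i = col M j" and "i \<noteq> j"
    then show False using gram[of i j] gram[of i i] by simp
  qed
  have S: "S \<subseteq> carrier_vec p" "finite S" using colM by (auto simp: S_def)
  have "lin_indpt S"
  proof (rule finite_lin_indpt2)
    show "finite S" by (rule S)
    show "S \<subseteq> carrier_vec p" by (rule S)
    fix a assume "lincomb a S = 0\<^sub>v p"
    then have 0: "(\<Sum>x\<in>S. a x * x $ l) = 0" if "l < p" for l
      using lincomb_index[OF that S(1), of a] that by (simp add: module_vec_def)
    show "\<forall>v\<in>S. a v = 0"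
    proof
      fix v assume v: "v \<in> S"
      then obtain i where i: "i < q" "c i \<noteq> 0" "v = col M i" by (auto simp: S_def)
      have "0 = (\<Sum>l<p. cnj (v $ l) * (\<Sum>x\<in>S. a x * x $ l))" by (simp add: 0)
      also have "\<dots> = (\<Sum>x\<in>S. a x * (\<Sum>l<p. cnj (v $ l) * x $ l))"
        unfolding sum_distrib_left by (subst sum.swap) (simp add: mult_ac)
      also have "\<dots> = (\<Sum>x\<in>S. if x = v then a v * complex_of_real (c i) else 0)"
      proof (rule sum.cong[OF refl])
        fix x assume "x \<in> S"
        then obtain j where j: "j < q" "c j \<noteq> 0" "x = col M j" by (auto simp: S_def)
        have "x = v \<longleftrightarrow> i = j" using inj i j by (auto dest: inj_onD)
        then show "a x * (\<Sum>l<p. cnj (v $ l) * x $ l) = (if x = v then a v * complex_of_real (c i) else 0)"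
          using gram[OF i(1) j(1)] i(3) j(3) by auto
      qed
      also have "\<dots> = a v * complex_of_real (c i)" using S v by simp
      finally show "a v = 0" using i by simp
    qed
  qed
  moreover have "T = S" if "S \<subseteq> T" "T \<subseteq> set (cols M)" "lin_indpt T" for T
  proof -
    have "col M i \<in> S" if "i < q" "col M i \<in> T" for i
    proof (cases "c i = 0")
      case True
      have "complex_of_real (sqnorm (col M i)) = (\<Sum>l<p. cnj (col M i $ l) * col M i $ l)"
        using M by (auto simp: sqnorm_def complex_norm_square mult.commute
          simp del: of_real_power intro!: sum.cong)
      then have "col M i = 0\<^sub>v p"
        using gram[OF that(1) that(1)] True sqnorm_eq_0_iff[OF colM] by simp
      moreover have "0\<^sub>v p \<notin> T"
      proof (rule zero_nin_lin_indpt)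
        show "T \<subseteq> carrier_vec p" using \<open>T \<subseteq> set (cols M)\<close> colM by (auto simp: cols)
        show "(UNIV :: complex set) \<noteq> {0}" by (metis UNIV_I singletonD zero_neq_one)
      qed (fact \<open>lin_indpt T\<close>)
      ultimately show ?thesis using that by simp
    qed (use that in \<open>auto simp: S_def\<close>)
    then show ?thesis using that by (auto simp: cols)
  qed
  ultimately have "maximal S (\<lambda>T. T \<subseteq> set (cols M) \<and> lin_indpt T)"
    unfolding maximal_def by (auto simp: cols S_def)
  from rank_card_indpt[OF M this] have "rank M = card S" .
  then show ?thesis using M card_image[OF inj] by (simp add: mrank_def S_def)
qed

section \<open>Singular values\<close>

text \<open>The columns of \<open>V\<close> are right singular vectors with singular values \<open>d\<close>, in any order. In contrast to a
  full singular value decomposition there is no left unitary factor, so that the spectral theorem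
  for \<open>B\<^sup>* B\<close> suffices for existence.\<close>

definition right_singular_basis :: "complex mat \<Rightarrow> complex mat \<Rightarrow> (nat \<Rightarrow> real) \<Rightarrow> bool" where
  "right_singular_basis B V d \<longleftrightarrow> unitary (dim_col B) V \<and>
     adj (B * V) * (B * V) = mat_diag (dim_col B) (\<lambda>i. complex_of_real ((d i)\<^sup>2)) \<and>
     (\<forall>i<dim_col B. 0 \<le> d i)"

lemma right_singular_basis_unitary:
  "right_singular_basis B V d \<Longrightarrow> B \<in> carrier_mat p q \<Longrightarrow> unitary q V"
  unfolding right_singular_basis_def carrier_mat_def by blast

text \<open>All \<open>dim_col B\<close> singular values, including the zeros which \<open>sing_vals\<close> omits when \<open>B\<close> has more
  columns than rows.\<close>

abbreviation sing_mset :: "complex mat \<Rightarrow> real multiset" where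
  "sing_mset B \<equiv> image_mset (\<lambda>z. sqrt (Re z)) (proots (char_poly (adj B * B)))"

lemma proots_prod_linear: "proots (\<Prod>a\<leftarrow>as. [:- a, 1:]) = mset (as :: complex list)"
proof (induction as)
  case (Cons a as)
  have "(\<Prod>a\<leftarrow>as. [:- a, 1:]) \<noteq> 0" by (auto simp: prod_list_zero_iff)
  then show ?case using Cons by (simp add: proots_mult del: mult_pCons_left)
qed simp

lemma right_singular_basis_sing_mset:
  assumes "right_singular_basis B V d"
  shows "sing_mset B = mset (map d [0..<dim_col B])"
proof -
  define q where "q = dim_col B"
  define D where "D = mat_diag q (\<lambda>i. complex_of_real ((d i)\<^sup>2))"
  have V: "unitary q V" and gram: "adj (B * V) * (B * V) = D" and d: "\<And>i. i < q \<Longrightarrow> 0 \<le> d i"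
    using assms by (auto simp: right_singular_basis_def q_def D_def)
  note Vc = unitaryD[OF V]
  have D: "D \<in> carrier_mat q q" by (simp add: D_def)
  have "adj B * B = V * D * adj V"
    unfolding gram[symmetric] using Vc q_def
    by (simp add: adj_mult' assoc_mult_mat' unitary_cancel[OF V])
  then have "similar_mat (adj B * B) D"
    unfolding similar_mat_def using Vc D q_def
    by (intro exI[of _ V] exI[of _ "adj V"] similar_mat_witI[of _ _ q]) (auto intro!: carrier_matI)
  then have "char_poly (adj B * B) = char_poly D" by (rule char_poly_similar)
  also have "\<dots> = (\<Prod>a\<leftarrow>diag_mat D. [:- a, 1:])"
    by (rule char_poly_upper_triangular[OF D]) (auto simp: D_def mat_diag_def upper_triangular_def)
  also have "diag_mat D = map (\<lambda>i. complex_of_real ((d i)\<^sup>2)) [0..<q]"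
    by (auto simp: D_def mat_diag_def diag_mat_def)
  finally have "proots (char_poly (adj B * B)) = mset (map (\<lambda>i. complex_of_real ((d i)\<^sup>2)) [0..<q])"
    by (simp only: proots_prod_linear)
  then have "sing_mset B = mset (map (\<lambda>i. sqrt (Re (complex_of_real ((d i)\<^sup>2)))) [0..<q])"
    by (simp add: image_mset.compositionality comp_def)
  also have "map (\<lambda>i. sqrt (Re (complex_of_real ((d i)\<^sup>2)))) [0..<q] = map d [0..<q]"
    using d by auto
  finally show ?thesis by (simp add: q_def)
qed

lemma right_singular_basis_sing_vals:
  assumes "right_singular_basis B V d"
  shows "sing_vals B = take (min (dim_row B) (dim_col B)) (rev (sort (map d [0..<dim_col B])))"
  unfolding sing_vals_def right_singular_basis_sing_mset[OF assms] sorted_list_of_multiset_mset ..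

lemma right_singular_basis_mrank:
  assumes "right_singular_basis B V d"
  shows "mrank B = card {i. i < dim_col B \<and> d i \<noteq> 0}"
proof -
  let ?p = "dim_row B" and ?q = "dim_col B"
  have V: "unitary ?q V" using assms by (simp add: right_singular_basis_def)
  note Vc = unitaryD[OF V]
  have BV: "B * V \<in> carrier_mat ?p ?q" using Vc by (intro carrier_matI) auto
  have "B * V * adj V = B" using Vc by (simp add: assoc_mult_mat')
  then have "mrank B \<le> mrank (B * V)" using mrank_mult_le_left[OF BV Vc(2)] by simp
  moreover have "mrank (B * V) \<le> mrank B" using mrank_mult_le_left[of B ?p ?q V ?q] Vc by simp
  moreover have "mrank (B * V) = card {i. i < ?q \<and> (d i)\<^sup>2 \<noteq> 0}"
    using assms by (intro mrank_orthogonal_cols[OF BV]) (simp add: right_singular_basis_def)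
  ultimately show ?thesis by simp
qed

lemma right_singular_basis_sing_val:
  assumes rsb: "right_singular_basis B V d"
    and dec: "\<And>i j. i \<le> j \<Longrightarrow> j < dim_col B \<Longrightarrow> d j \<le> d i"
  shows "sing_val B (Suc i) = (if i < dim_col B then d i else 0)"
proof -
  let ?p = "dim_row B" and ?q = "dim_col B"
  have "sort (map d [0..<?q]) = rev (map d [0..<?q])"
  proof (rule properties_for_sort)
    show "sorted (rev (map d [0..<?q]))"
      unfolding sorted_rev_iff_nth_mono using dec by auto
  qed simp
  then have sv: "sing_vals B = take (min ?p ?q) (map d [0..<?q])"
    unfolding right_singular_basis_sing_vals[OF rsb] by simp
  \<comment> \<open>The values cut off by \<open>sing_vals\<close> vanish, because the rank is at most the number of rows.\<close>
  have tail: "d i = 0" if "i < ?q" "\<not> i < ?p"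
  proof (rule ccontr)
    assume "d i \<noteq> 0"
    moreover have "0 \<le> d i" using rsb that by (simp add: right_singular_basis_def)
    ultimately have "0 < d i" by simp
    then have "{..i} \<subseteq> {j. j < ?q \<and> d j \<noteq> 0}"
      using that dec[of _ i] by fastforce
    then have "card {..i} \<le> mrank B"
      unfolding right_singular_basis_mrank[OF rsb] by (intro card_mono) auto
    then show False using mrank_le_dim(1)[of B ?p ?q] that by auto
  qed
  show ?thesis using tail by (auto simp: sing_val_def sv)
qed

lemma right_singular_basis_exists:
  obtains V d where "right_singular_basis B V d" "\<And>i j. i \<le> j \<Longrightarrow> j < dim_col B \<Longrightarrow> d j \<le> d i"
proof -
  let ?p = "dim_row B" and ?q = "dim_col B"
  let ?H = "adj B * B"
  have H: "?H \<in> carrier_mat ?q ?q" by (intro carrier_matI) auto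
  have herm: "adj ?H = ?H" by (simp add: adj_mult')
  obtain as where as: "char_poly ?H = (\<Prod>a\<leftarrow>as. [:- a, 1:])" "length as = ?q"
    using char_poly_factorized[OF H] by blast
  \<comment> \<open>The order of the eigenvalues in the diagonalization is free, so they are sorted beforehand.\<close>
  define es where "es = rev (sort_key Re as)"
  have "mset (map (\<lambda>a. [:- a, 1:]) es) = mset (map (\<lambda>a. [:- a, 1:]) as)"
    by (simp add: es_def)
  then have "char_poly ?H = (\<Prod>a\<leftarrow>es. [:- a, 1:])"
    unfolding as by (metis prod_mset_prod_list)
  from hermitian_diagonalization[OF H herm this] obtain V where V: "unitary ?q V"
    and VH: "adj V * ?H * V = mat_diag ?q (\<lambda>i. es ! i)" by blast
  note Vc = unitaryD[OF V]
  have BV: "B * V \<in> carrier_mat ?p ?q" using Vc by (intro carrier_matI) auto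
  have gram: "adj (B * V) * (B * V) = mat_diag ?q (\<lambda>i. es ! i)"
    unfolding VH[symmetric] using Vc by (simp add: adj_mult' assoc_mult_mat')
  have es: "es ! i = complex_of_real (sqnorm (col (B * V) i))" if "i < ?q" for i
  proof -
    have "es ! i = (adj (B * V) * (B * V)) $$ (i, i)"
      unfolding gram using that by (simp add: mat_diag_def)
    also have "\<dots> = (\<Sum>l<?p. cnj ((B * V) $$ (l, i)) * (B * V) $$ (l, i))"
      using mult_index[OF adj_carrier[OF BV] BV that that] BV that Vc by (auto intro!: sum.cong)
    also have "\<dots> = complex_of_real (sqnorm (col (B * V) i))"
      using BV Vc that by (auto simp: sqnorm_def complex_norm_square mult.commute
          simp del: of_real_power index_mult_mat(1) intro!: sum.cong)
    finally show ?thesis .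
  qed
  define d where "d i = sqrt (Re (es ! i))" for i
  have "right_singular_basis B V d"
    unfolding right_singular_basis_def gram
  proof (intro conjI allI impI V)
    show "mat_diag ?q (\<lambda>i. es ! i) = mat_diag ?q (\<lambda>i. complex_of_real ((d i)\<^sup>2))"
      by (rule eq_matI) (auto simp: mat_diag_def d_def es sqnorm_nonneg simp del: of_real_power)
    show "0 \<le> d i" if "i < ?q" for i using that by (simp add: d_def es sqnorm_nonneg)
  qed
  moreover have "d j \<le> d i" if "i \<le> j" "j < ?q" for i j
  proof -
    have len: "length es = ?q" by (simp add: es_def as)
    have "sorted (rev (map Re es))"
      unfolding es_def rev_map[symmetric] by simp
    then have "map Re es ! j \<le> map Re es ! i"
      using that len unfolding sorted_rev_iff_nth_mono by (metis length_map)
    then show ?thesis using that len by (simp add: d_def)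
  qed
  ultimately show thesis by (rule that)
qed

theorem sing_val_basis:
  obtains V where "right_singular_basis B V (\<lambda>i. sing_val B (Suc i))"
proof -
  obtain V d where rsb: "right_singular_basis B V d"
    and dec: "\<And>i j. i \<le> j \<Longrightarrow> j < dim_col B \<Longrightarrow> d j \<le> d i"
    using right_singular_basis_exists[of B] by blast
  note sv = right_singular_basis_sing_val[OF rsb dec]
  have "mat_diag (dim_col B) (\<lambda>i. complex_of_real ((d i)\<^sup>2)) =
    mat_diag (dim_col B) (\<lambda>i. complex_of_real ((sing_val B (Suc i))\<^sup>2))"
    by (rule eq_matI) (auto simp: mat_diag_def sv)
  then have "right_singular_basis B V (\<lambda>i. sing_val B (Suc i))"
    using rsb by (simp add: right_singular_basis_def sv)
  then show thesis by (rule that)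
qed

lemma sing_val_nonneg: "0 \<le> sing_val B (Suc i)"
proof -
  obtain V d where "right_singular_basis B V d" "\<And>i j. i \<le> j \<Longrightarrow> j < dim_col B \<Longrightarrow> d j \<le> d i"
    using right_singular_basis_exists[of B] by blast
  from right_singular_basis_sing_val[OF this, of i] this(1) show ?thesis
    by (auto simp: right_singular_basis_def)
qed

lemma sing_val_eq_0: "dim_row B \<le> i \<or> dim_col B \<le> i \<Longrightarrow> sing_val B (Suc i) = 0"
proof -
  assume i: "dim_row B \<le> i \<or> dim_col B \<le> i"
  obtain V d where "right_singular_basis B V d" "\<And>i j. i \<le> j \<Longrightarrow> j < dim_col B \<Longrightarrow> d j \<le> d i"
    using right_singular_basis_exists[of B] by blast
  then have "length (sing_vals B) \<le> dim_row B" "length (sing_vals B) \<le> dim_col B"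
    by (auto simp: right_singular_basis_sing_vals)
  then show ?thesis using i by (auto simp: sing_val_def)
qed

lemma sing_val_antimono: "i \<le> j \<Longrightarrow> sing_val B (Suc j) \<le> sing_val B (Suc i)"
proof -
  assume ij: "i \<le> j"
  obtain V d where rsb: "right_singular_basis B V d"
    and dec: "\<And>i j. i \<le> j \<Longrightarrow> j < dim_col B \<Longrightarrow> d j \<le> d i"
    using right_singular_basis_exists[of B] by blast
  show ?thesis
  proof (cases "j < dim_col B")
    case True
    then show ?thesis using right_singular_basis_sing_val[OF rsb dec] dec[OF ij] ij by simp
  next
    case False
    then show ?thesis using sing_val_nonneg[of B i] sing_val_eq_0[of B j] by simp
  qed
qed

lemma mrank_eq_card_sing_val: "mrank B = card {i. sing_val B (Suc i) \<noteq> 0}"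
proof -
  obtain V where rsb: "right_singular_basis B V (\<lambda>i. sing_val B (Suc i))" by (rule sing_val_basis[of B])
  have "{i. i < dim_col B \<and> sing_val B (Suc i) \<noteq> 0} = {i. sing_val B (Suc i) \<noteq> 0}"
    using sing_val_eq_0[of B] by (meson linorder_not_less)
  then show ?thesis using right_singular_basis_mrank[OF rsb] by simp
qed

lemma sing_val_pos_iff: "0 < sing_val B (Suc i) \<longleftrightarrow> i < mrank B"
proof -
  let ?S = "{i. sing_val B (Suc i) \<noteq> 0}"
  have fin: "finite ?S"
    by (rule finite_subset[of _ "{..<dim_col B}"]) (use sing_val_eq_0[of B] in \<open>auto simp: not_le[symmetric]\<close>)
  have down: "i \<in> ?S" if "j \<in> ?S" "i \<le> j" for i j
    using sing_val_antimono[OF that(2), of B] sing_val_nonneg[of B j] that(1) by auto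
  have "0 < sing_val B (Suc i) \<longleftrightarrow> i \<in> ?S" using sing_val_nonneg[of B i] by auto
  also have "\<dots> \<longleftrightarrow> i < card ?S"
  proof
    assume "i \<in> ?S"
    then have "{..i} \<subseteq> ?S" using down by blast
    then have "card {..i} \<le> card ?S" by (intro card_mono fin)
    then show "i < card ?S" by simp
  next
    assume "i < card ?S"
    show "i \<in> ?S"
    proof (rule ccontr)
      assume "i \<notin> ?S"
      then have "?S \<subseteq> {..<i}" using down by (auto simp: not_le[symmetric])
      then have "card ?S \<le> card {..<i}" by (intro card_mono) auto
      then show False using \<open>i < card ?S\<close> by simp
    qed
  qed
  finally show ?thesis by (simp add: mrank_eq_card_sing_val)
qed

lemma sing_val_cong_gram:
  assumes "dim_col B = dim_col B'" "adj B * B = adj B' * B'"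
  shows "sing_val B (Suc i) = sing_val B' (Suc i)"
proof -
  obtain V d where rsb: "right_singular_basis B V d"
    and dec: "\<And>i j. i \<le> j \<Longrightarrow> j < dim_col B \<Longrightarrow> d j \<le> d i"
    using right_singular_basis_exists[of B] by blast
  have V: "V \<in> carrier_mat (dim_col B) (dim_col B)"
    using rsb by (simp add: right_singular_basis_def unitary_def)
  have *: "adj (C * V) * (C * V) = adj V * (adj C * C) * V" if "dim_col C = dim_col B" for C
    using V that by (simp add: adj_mult' assoc_mult_mat')
  have "right_singular_basis B' V d"
    using rsb assms *[of B] *[of B'] by (simp add: right_singular_basis_def)
  then show ?thesis
    using right_singular_basis_sing_val[OF rsb dec] right_singular_basis_sing_val[of B' V d] dec assms(1)
    by simp
qed

lemma sqnorm_singular: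
  assumes B: "B \<in> carrier_mat p q" and x: "x \<in> carrier_vec q" and rsb: "right_singular_basis B V d"
  shows "sqnorm (B *\<^sub>v x) = (\<Sum>i<q. (d i)\<^sup>2 * (cmod ((adj V *\<^sub>v x) $ i))\<^sup>2)"
    and "sqnorm x = (\<Sum>i<q. (cmod ((adj V *\<^sub>v x) $ i))\<^sup>2)"
proof -
  have V: "unitary q V" using rsb B by (simp add: right_singular_basis_def)
  note Vc = unitaryD[OF V]
  have y: "adj V *\<^sub>v x \<in> carrier_vec q" using Vc x by (intro mult_mat_vec_carrier)
  have "V *\<^sub>v (adj V *\<^sub>v x) = x"
    using assoc_mult_mat_vec[OF Vc(1,2) x] Vc x by simp
  then have "B *\<^sub>v x = (B * V) *\<^sub>v (adj V *\<^sub>v x)"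
    using assoc_mult_mat_vec[OF B Vc(1) y] by simp
  moreover have "sqnorm ((B * V) *\<^sub>v (adj V *\<^sub>v x)) = (\<Sum>i<q. (d i)\<^sup>2 * (cmod ((adj V *\<^sub>v x) $ i))\<^sup>2)"
    using rsb B y Vc by (intro sqnorm_mult_vec_diag[of _ p]) (auto simp: right_singular_basis_def)
  ultimately show "sqnorm (B *\<^sub>v x) = (\<Sum>i<q. (d i)\<^sup>2 * (cmod ((adj V *\<^sub>v x) $ i))\<^sup>2)" by simp
  have "sqnorm (adj V *\<^sub>v x) = sqnorm x"
    using Vc x by (intro sqnorm_isometry) auto
  then show "sqnorm x = (\<Sum>i<q. (cmod ((adj V *\<^sub>v x) $ i))\<^sup>2)"
    using Vc by (simp add: sqnorm_def)
qed

text \<open>The two halves of the Courant--Fischer principle: \<open>B\<close> stretches vectors from the span of the leading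
  right singular vectors by at least, and those orthogonal to them by at most, the singular value
  at the border.\<close>

lemma sqnorm_mult_vec_ge:
  assumes B: "B \<in> carrier_mat p q" and x: "x \<in> carrier_vec q"
    and rsb: "right_singular_basis B V (\<lambda>i. sing_val B (Suc i))"
    and 0: "\<And>j. t < j \<Longrightarrow> j < q \<Longrightarrow> (adj V *\<^sub>v x) $ j = 0"
  shows "(sing_val B (Suc t))\<^sup>2 * sqnorm x \<le> sqnorm (B *\<^sub>v x)"
  unfolding sqnorm_singular[OF B x rsb] sum_distrib_left
proof (rule sum_mono)
  fix j assume "j \<in> {..<q}"
  then have j: "j < q" by simp
  show "(sing_val B (Suc t))\<^sup>2 * (cmod ((adj V *\<^sub>v x) $ j))\<^sup>2
      \<le> (sing_val B (Suc j))\<^sup>2 * (cmod ((adj V *\<^sub>v x) $ j))\<^sup>2"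
  proof (cases "t < j")
    case False
    then show ?thesis
      using sing_val_antimono[of j t B] sing_val_nonneg[of B t]
      by (intro mult_right_mono power_mono) auto
  qed (use 0 j in simp)
qed

lemma sqnorm_mult_vec_le:
  assumes B: "B \<in> carrier_mat p q" and x: "x \<in> carrier_vec q"
    and rsb: "right_singular_basis B V (\<lambda>i. sing_val B (Suc i))"
    and 0: "\<And>j. j < t \<Longrightarrow> j < q \<Longrightarrow> (adj V *\<^sub>v x) $ j = 0"
  shows "sqnorm (B *\<^sub>v x) \<le> (sing_val B (Suc t))\<^sup>2 * sqnorm x"
  unfolding sqnorm_singular[OF B x rsb] sum_distrib_left
proof (rule sum_mono)
  fix j assume "j \<in> {..<q}"
  then have j: "j < q" by simp
  show "(sing_val B (Suc j))\<^sup>2 * (cmod ((adj V *\<^sub>v x) $ j))\<^sup>2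
      \<le> (sing_val B (Suc t))\<^sup>2 * (cmod ((adj V *\<^sub>v x) $ j))\<^sup>2"
  proof (cases "j < t")
    case False
    then show ?thesis
      using sing_val_antimono[of t j B] sing_val_nonneg[of B j]
      by (intro mult_right_mono power_mono) auto
  qed (use 0 j in simp)
qed

text \<open>A solution is a right singular vector for a singular value that vanishes for lack of rank.\<close>

lemma underdetermined_solution:
  assumes M: "M \<in> carrier_mat r q" and rq: "r < q"
  obtains x :: "complex vec" where "x \<in> carrier_vec q" "x \<noteq> 0\<^sub>v q" "M *\<^sub>v x = 0\<^sub>v r"
proof -
  obtain V where rsb: "right_singular_basis M V (\<lambda>i. sing_val M (Suc i))" by (rule sing_val_basis[of M])
  have V: "unitary q V" using rsb M by (simp add: right_singular_basis_def)
  note Vc = unitaryD[OF V]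
  define x where "x = V *\<^sub>v unit_vec q r"
  have x: "x \<in> carrier_vec q" using Vc by (simp add: x_def)
  have y: "adj V *\<^sub>v x = unit_vec q r"
    using assoc_mult_mat_vec[OF Vc(2,1) unit_vec_carrier, of r] Vc by (simp add: x_def)
  have "sqnorm (M *\<^sub>v x) \<le> (sing_val M (Suc r))\<^sup>2 * sqnorm x"
    by (rule sqnorm_mult_vec_le[OF M x rsb]) (simp add: y rq)
  also have "sing_val M (Suc r) = 0" using M by (intro sing_val_eq_0) simp
  finally have "sqnorm (M *\<^sub>v x) = 0" using sqnorm_nonneg[of "M *\<^sub>v x"] by simp
  then have "M *\<^sub>v x = 0\<^sub>v r" using sqnorm_eq_0_iff[OF mult_mat_vec_carrier[OF M x]] by simp
  moreover have "x \<noteq> 0\<^sub>v q"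
  proof
    assume "x = 0\<^sub>v q"
    then have "(adj V *\<^sub>v x) $ r = 0" using mult_vec_index[OF Vc(2) x rq] by simp
    then show False using rq by (simp add: y)
  qed
  ultimately show thesis using that x by blast
qed

text \<open>A nonzero vector \<open>x\<close> that is orthogonal to the first \<open>i\<close> right singular vectors of \<open>X - Y\<close>, to the
  first \<open>r\<close> ones of \<open>Y\<close> and to all but the first \<open>i + r + 1\<close> ones of \<open>X\<close> exists, because these are
  \<open>q - 1\<close> linear conditions. It satisfies \<open>Y x = 0\<close>, so that \<open>X x = (X - Y) x\<close>, and its length after
  multiplication by \<open>X\<close> and by \<open>X - Y\<close> is bounded from below and from above.\<close>

theorem weyl_low_rank:
  assumes X: "X \<in> carrier_mat p q" and Y: "Y \<in> carrier_mat p q" and r: "mrank Y \<le> r"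
  shows "sing_val X (Suc (i + r)) \<le> sing_val (X - Y) (Suc i)"
proof (cases "i + r < q")
  case False
  then have "sing_val X (Suc (i + r)) = 0" using X by (intro sing_val_eq_0) auto
  then show ?thesis using sing_val_nonneg by simp
next
  case True
  let ?F = "X - Y"
  have F: "?F \<in> carrier_mat p q" using Y by auto
  obtain VX where VX: "right_singular_basis X VX (\<lambda>i. sing_val X (Suc i))" by (rule sing_val_basis[of "X"])
  obtain VY where VY: "right_singular_basis Y VY (\<lambda>i. sing_val Y (Suc i))" by (rule sing_val_basis[of "Y"])
  obtain VF where VF: "right_singular_basis ?F VF (\<lambda>i. sing_val ?F (Suc i))" by (rule sing_val_basis[of "?F"])
  have c: "adj VX \<in> carrier_mat q q" "adj VY \<in> carrier_mat q q" "adj VF \<in> carrier_mat q q"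
    using VX VY VF X Y F by (auto simp: right_singular_basis_def unitary_def)
  define M where "M = mat (q - 1) q (\<lambda>(l, j). if l < i then adj VF $$ (l, j)
     else if l < i + r then adj VY $$ (l - i, j) else adj VX $$ (Suc l, j))"
  have M: "M \<in> carrier_mat (q - 1) q" by (simp add: M_def)
  obtain x where x: "x \<in> carrier_vec q" "x \<noteq> 0\<^sub>v q" and Mx: "M *\<^sub>v x = 0\<^sub>v (q - 1)"
    using underdetermined_solution[OF M] True by auto
  have Mx0: "(\<Sum>j<q. M $$ (l, j) * x $ j) = 0" if "l < q - 1" for l
    using arg_cong[OF Mx, of "\<lambda>v. v $ l"] mult_vec_index[OF M x(1) that] that by simp
  have xF: "(adj VF *\<^sub>v x) $ j = 0" if "j < i" "j < q" for j
    using Mx0[of j] that True c x by (simp add: mult_vec_index[OF c(3) x(1) that(2)] M_def)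
  have xY: "(adj VY *\<^sub>v x) $ j = 0" if "j < r" "j < q" for j
    using Mx0[of "i + j"] that True c x by (simp add: mult_vec_index[OF c(2) x(1) that(2)] M_def)
  have xX: "(adj VX *\<^sub>v x) $ j = 0" if "i + r < j" "j < q" for j
    using Mx0[of "j - 1"] that True c x
    unfolding mult_vec_index[OF c(1) x(1) that(2)] by (cases j) (auto simp: M_def)
  have "sqnorm (Y *\<^sub>v x) \<le> (sing_val Y (Suc r))\<^sup>2 * sqnorm x"
    by (rule sqnorm_mult_vec_le[OF Y x(1) VY xY])
  also have "sing_val Y (Suc r) = 0"
    using sing_val_pos_iff[of Y r] sing_val_nonneg[of Y r] r by linarith
  finally have "sqnorm (Y *\<^sub>v x) = 0" using sqnorm_nonneg[of "Y *\<^sub>v x"] by simp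
  then have Yx: "Y *\<^sub>v x = 0\<^sub>v p" using sqnorm_eq_0_iff[OF mult_mat_vec_carrier[OF Y x(1)]] by simp
  have "?F *\<^sub>v x = X *\<^sub>v x"
    using X Y x Yx by (simp add: minus_mult_distrib_mat_vec)
  moreover have "(sing_val X (Suc (i + r)))\<^sup>2 * sqnorm x \<le> sqnorm (X *\<^sub>v x)"
    by (rule sqnorm_mult_vec_ge[OF X x(1) VX xX])
  moreover have "sqnorm (?F *\<^sub>v x) \<le> (sing_val ?F (Suc i))\<^sup>2 * sqnorm x"
    by (rule sqnorm_mult_vec_le[OF F x(1) VF xF])
  ultimately have "(sing_val X (Suc (i + r)))\<^sup>2 * sqnorm x \<le> (sing_val ?F (Suc i))\<^sup>2 * sqnorm x"
    by simp
  moreover have "0 < sqnorm x"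
    using sqnorm_eq_0_iff[OF x(1)] x(2) sqnorm_nonneg[of x] by simp
  ultimately have "(sing_val X (Suc (i + r)))\<^sup>2 \<le> (sing_val ?F (Suc i))\<^sup>2" by simp
  then show ?thesis by (rule power2_le_imp_le) (rule sing_val_nonneg)
qed

section \<open>Singular values of the adjoint\<close>

lemma char_poly_matrix_prod:
  assumes A: "A \<in> carrier_mat p q" and B: "B \<in> carrier_mat q p"
  shows "char_poly_matrix (A * B) =
    [:0, 1:] \<cdot>\<^sub>m 1\<^sub>m p - map_mat (\<lambda>a. [:a:]) A * map_mat (\<lambda>a. [:a:]) (B :: 'a::comm_ring_1 mat)"
proof -
  have "char_poly_matrix (A * B) = [:0, 1:] \<cdot>\<^sub>m 1\<^sub>m p - map_mat (\<lambda>a. [:a:]) (A * B)"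
    by (rule eq_matI) (use A B in \<open>auto simp: char_poly_matrix_def\<close>)
  then show ?thesis by (simp only: map_poly_mult(1)[OF A B])
qed

text \<open>Both sides are \<open>x\<^sup>q\<close> times the determinant of the block matrix \<open>M\<close> with rows \<open>(x 1, A)\<close> and \<open>(B, 1)\<close>:
  the block row operation \<open>L\<close> clears the upper right corner, and \<open>R\<close>, of determinant \<open>x\<^sup>q\<close>, the lower
  left one.\<close>

lemma char_poly_mult_commute:
  fixes A B :: "'a::field mat"
  assumes A: "A \<in> carrier_mat p q" and B: "B \<in> carrier_mat q p"
  shows "[:0, 1:] ^ q * char_poly (A * B) = [:0, 1:] ^ p * char_poly (B * A)"
proof -
  define x where "x = ([:0, 1:] :: 'a poly)"
  define PA where "PA = map_mat (\<lambda>a. [:a:]) A"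
  define PB where "PB = map_mat (\<lambda>a. [:a:]) B"
  have PA: "PA \<in> carrier_mat p q" and PB: "PB \<in> carrier_mat q p"
    using A B by (auto simp: PA_def PB_def)
  let ?M = "four_block_mat (x \<cdot>\<^sub>m 1\<^sub>m p) PA PB (1\<^sub>m q)"
  let ?L = "four_block_mat (1\<^sub>m p) (- PA) (0\<^sub>m q p) (1\<^sub>m q)"
  let ?R = "four_block_mat (1\<^sub>m p) (0\<^sub>m p q) (- PB) (x \<cdot>\<^sub>m 1\<^sub>m q)"
  have c: "?M \<in> carrier_mat (p + q) (p + q)" "?L \<in> carrier_mat (p + q) (p + q)"
    "?R \<in> carrier_mat (p + q) (p + q)"
    by auto
  have PAB: "PA * PB \<in> carrier_mat p p" "PB * PA \<in> carrier_mat q q" using PA PB by auto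
  have LM: "?L * ?M = four_block_mat (char_poly_matrix (A * B)) (0\<^sub>m p q) PB (1\<^sub>m q)"
  proof -
    have "1\<^sub>m p * (x \<cdot>\<^sub>m 1\<^sub>m p) + - PA * PB = char_poly_matrix (A * B)"
      unfolding char_poly_matrix_prod[OF A B] x_def[symmetric] PA_def[symmetric] PB_def[symmetric]
      using PA PB PAB by (intro eq_matI) (auto simp: uminus_mult_left_mat)
    moreover have "1\<^sub>m p * PA + - PA * 1\<^sub>m q = 0\<^sub>m p q"
      using PA by (intro eq_matI) auto
    moreover have "0\<^sub>m q p * (x \<cdot>\<^sub>m 1\<^sub>m p) + 1\<^sub>m q * PB = PB"
      using PB by (intro eq_matI) auto
    moreover have "0\<^sub>m q p * PA + 1\<^sub>m q * 1\<^sub>m q = (1\<^sub>m q :: 'a poly mat)"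
      using PA by (intro eq_matI) auto
    ultimately show ?thesis
      using PA PB by (subst mult_four_block_mat[of _ p p _ q _ q _ _ p _ q]) auto
  qed
  have RM: "?R * ?M = four_block_mat (x \<cdot>\<^sub>m 1\<^sub>m p) PA (0\<^sub>m q p) (char_poly_matrix (B * A))"
  proof -
    have "- PB * PA + x \<cdot>\<^sub>m 1\<^sub>m q * 1\<^sub>m q = char_poly_matrix (B * A)"
      unfolding char_poly_matrix_prod[OF B A] x_def[symmetric] PA_def[symmetric] PB_def[symmetric]
      using PA PB PAB by (intro eq_matI) (auto simp: uminus_mult_left_mat)
    moreover have "- PB * (x \<cdot>\<^sub>m 1\<^sub>m p) + x \<cdot>\<^sub>m 1\<^sub>m q * PB = 0\<^sub>m q p"
    proof -
      have mPB: "- PB \<in> carrier_mat q p" using PB by simp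
      have "- PB * (x \<cdot>\<^sub>m 1\<^sub>m p) = x \<cdot>\<^sub>m (- PB * 1\<^sub>m p)"
        by (rule mult_smult_distrib[OF mPB one_carrier_mat])
      also have "- PB * 1\<^sub>m p = - PB" by (rule right_mult_one_mat[OF mPB])
      finally have 1: "- PB * (x \<cdot>\<^sub>m 1\<^sub>m p) = x \<cdot>\<^sub>m - PB" .
      have "x \<cdot>\<^sub>m 1\<^sub>m q * PB = x \<cdot>\<^sub>m (1\<^sub>m q * PB)"
        by (rule mult_smult_assoc_mat[OF one_carrier_mat PB])
      also have "1\<^sub>m q * PB = PB" by (rule left_mult_one_mat[OF PB])
      finally have 2: "x \<cdot>\<^sub>m 1\<^sub>m q * PB = x \<cdot>\<^sub>m PB" .
      show ?thesis unfolding 1 2 by (rule eq_matI) (use PB in auto)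
    qed
    moreover have "1\<^sub>m p * (x \<cdot>\<^sub>m 1\<^sub>m p) + 0\<^sub>m p q * PB = x \<cdot>\<^sub>m 1\<^sub>m p"
      using PB by (intro eq_matI) auto
    moreover have "1\<^sub>m p * PA + 0\<^sub>m p q * 1\<^sub>m q = PA"
      using PA by (intro eq_matI) auto
    ultimately show ?thesis
      using PA PB by (subst mult_four_block_mat[of _ p p _ q _ q _ _ p _ q]) auto
  qed
  have cp: "char_poly_matrix (A * B) \<in> carrier_mat p p" "char_poly_matrix (B * A) \<in> carrier_mat q q"
    using mult_carrier_mat[OF A B] mult_carrier_mat[OF B A] by auto
  have "det ?L = 1"
    using PA by (subst det_four_block_mat_lower_left_zero[of _ p _ q]) auto
  moreover have "det (?L * ?M) = char_poly (A * B)"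
    unfolding LM char_poly_def using cp PB
    by (subst det_four_block_mat_upper_right_zero[of _ p _ q]) auto
  ultimately have 1: "det ?M = char_poly (A * B)"
    using det_mult[OF c(2) c(1)] by simp
  have "det ?R = x ^ q"
    using PB by (subst det_four_block_mat_upper_right_zero[of _ p _ q]) (auto simp: det_smult)
  moreover have "det (?R * ?M) = x ^ p * char_poly (B * A)"
    unfolding RM char_poly_def using cp PA
    by (subst det_four_block_mat_lower_left_zero[of _ p _ q]) (auto simp: det_smult)
  ultimately show ?thesis
    using det_mult[OF c(3) c(1)] 1 by (simp add: x_def[symmetric] del: mult_pCons_left)
qed

lemma take_rev_sort_add_zeros:
  assumes "\<And>x. x \<in> set xs \<Longrightarrow> (0::real) \<le> x" and "r \<le> length xs"
  shows "take r (rev (sorted_list_of_multiset (replicate_mset n 0 + mset xs))) =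
    take r (rev (sorted_list_of_multiset (mset xs)))"
proof -
  have "sorted_list_of_multiset (replicate_mset n 0 + mset xs) = sort (replicate n 0 @ xs)"
    by (simp flip: sorted_list_of_multiset_mset)
  also have "\<dots> = replicate n 0 @ sort xs"
    by (rule properties_for_sort) (use assms in \<open>auto simp: sorted_append\<close>)
  finally show ?thesis using assms(2) by simp
qed

text \<open>The characteristic polynomials of \<open>B\<^sup>* B\<close> and \<open>B B\<^sup>*\<close> agree up to a power of \<open>x\<close>, hence their roots agree
  up to zeros. These come last in descending order, so that they do not affect the first
  \<open>min p q\<close> entries.\<close>

lemma sing_vals_adj: "sing_vals (adj B) = sing_vals B"
proof -
  let ?p = "dim_row B" and ?q = "dim_col B"
  define c where "c = char_poly (adj B * B)"
  define c' where "c' = char_poly (B * adj B)"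
  have monic: "lead_coeff (char_poly (adj C * C)) = 1" for C :: "complex mat"
  proof -
    have "adj C * C \<in> carrier_mat (dim_col C) (dim_col C)" by (intro carrier_matI) auto
    from degree_monic_char_poly[OF this] show ?thesis by (elim conjE) (simp only:)
  qed
  have ne: "c \<noteq> 0" "c' \<noteq> 0"
    using monic[of B] monic[of "adj B"] by (auto simp: c_def c'_def)
  have X: "proots ([:0, 1:] ^ n * f) = replicate_mset n 0 + proots f" if "f \<noteq> 0" for n and f :: "complex poly"
    using that by (simp add: proots_mult proots_power del: mult_pCons_left)
  have "[:0, 1:] ^ ?p * c = [:0, 1:] ^ ?q * c'"
    unfolding c_def c'_def by (rule char_poly_mult_commute) (auto intro: carrier_matI)
  then have "replicate_mset ?p 0 + proots c = replicate_mset ?q 0 + proots c'"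
    using X[OF ne(1), of ?p] X[OF ne(2), of ?q] by argo
  then have "image_mset (\<lambda>z. sqrt (Re z)) (replicate_mset ?p 0 + proots c) =
      image_mset (\<lambda>z. sqrt (Re z)) (replicate_mset ?q 0 + proots c')" by argo
  then have eq: "replicate_mset ?p 0 + sing_mset B = replicate_mset ?q 0 + sing_mset (adj B)"
    unfolding image_mset_union image_replicate_mset c_def c'_def by simp
  have *: "sing_vals C = take (min ?p ?q) (rev (sorted_list_of_multiset (replicate_mset n 0 + sing_mset C)))"
    if "min (dim_row C) (dim_col C) = min ?p ?q" for C n
  proof -
    obtain V where rsb: "right_singular_basis C V (\<lambda>i. sing_val C (Suc i))" by (rule sing_val_basis[of C])
    show ?thesis
      unfolding sing_vals_def that right_singular_basis_sing_mset[OF rsb]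
      by (rule take_rev_sort_add_zeros[symmetric]) (use that sing_val_nonneg in auto)
  qed
  show ?thesis
    using *[of "adj B" ?q] *[of B ?p] eq by (simp add: min.commute)
qed

lemma sing_val_adj: "sing_val (adj B) = sing_val B"
  by (rule ext) (simp add: sing_val_def sing_vals_adj)

lemma mrank_adj: "mrank (adj B) = mrank B"
  by (simp add: mrank_eq_card_sing_val sing_val_adj)

section \<open>The pseudoinverse\<close>

definition is_pinv :: "complex mat \<Rightarrow> complex mat \<Rightarrow> bool" where
  "is_pinv B X \<longleftrightarrow> X \<in> carrier_mat (dim_col B) (dim_row B) \<and>
     B * X * B = B \<and> X * B * X = X \<and> adj (B * X) = B * X \<and> adj (X * B) = X * B"

text \<open>\<open>B X\<close> and \<open>B Y\<close> are Hermitian projections with the same range, hence equal, and likewise \<open>X B\<close> and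
  \<open>Y B\<close>. Then \<open>X = X B X = Y B X = Y B Y = Y\<close>.\<close>

lemma is_pinv_unique:
  assumes X: "is_pinv B X" and Y: "is_pinv B Y"
  shows "X = Y"
proof -
  have d: "dim_row X = dim_col B" "dim_col X = dim_row B" "dim_row Y = dim_col B" "dim_col Y = dim_row B"
    using X Y by (auto simp: is_pinv_def)
  have Xe: "B * X * B = B" "X * B * X = X" "adj (B * X) = B * X" "adj (X * B) = X * B"
    and Ye: "B * Y * B = B" "Y * B * Y = Y" "adj (B * Y) = B * Y" "adj (Y * B) = Y * B"
    using X Y by (auto simp: is_pinv_def)
  have "B * X = (B * Y * B) * X" by (simp only: Ye)
  also have "\<dots> = (B * Y) * (B * X)" using d by (simp add: assoc_mult_mat')
  also have "\<dots> = adj (B * Y) * adj (B * X)" by (simp only: Xe Ye)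
  also have "\<dots> = adj (B * X * (B * Y))" using d by (simp add: adj_mult')
  also have "B * X * (B * Y) = (B * X * B) * Y" using d by (simp add: assoc_mult_mat')
  also have "\<dots> = B * Y" by (simp only: Xe)
  finally have BX: "B * X = B * Y" by (simp only: Ye)
  have "X * B = X * (B * Y * B)" by (simp only: Ye)
  also have "\<dots> = (X * B) * (Y * B)" using d by (simp add: assoc_mult_mat')
  also have "\<dots> = adj (X * B) * adj (Y * B)" by (simp only: Xe Ye)
  also have "\<dots> = adj (Y * B * (X * B))" using d by (simp add: adj_mult')
  also have "Y * B * (X * B) = Y * (B * X * B)" using d by (simp add: assoc_mult_mat')
  also have "\<dots> = Y * B" by (simp only: Xe)
  finally have XB: "X * B = Y * B" by (simp only: Ye)
  have "X = X * B * X" by (simp only: Xe)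
  also have "\<dots> = Y * (B * X)" using d by (simp add: XB assoc_mult_mat')
  also have "\<dots> = Y * B * Y" using d by (simp add: BX assoc_mult_mat')
  finally show ?thesis by (simp only: Ye)
qed

lemma pinv_eqI: "is_pinv B X \<Longrightarrow> pinv B = X"
  unfolding pinv_def is_pinv_def[symmetric]
  by (rule the_equality) (auto intro: is_pinv_unique)

text \<open>With \<open>B\<^sup>* B = V D\<^sup>2 V\<^sup>*\<close> the pseudoinverse is \<open>V D\<^sup>-\<^sup>2 V\<^sup>* B\<^sup>*\<close>, where zeros on
  the diagonal are left in place; here division by zero gives the right convention.\<close>

lemma pinv_singular:
  assumes B: "B \<in> carrier_mat p q"
    and rsb: "right_singular_basis B V (\<lambda>i. sing_val B (Suc i))"
  shows "is_pinv B (pinv B)"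
    and "pinv B * B = V * mat_diag q (\<lambda>i. complex_of_real (if i < mrank B then 1 else 0)) * adj V"
proof -
  define s where "s i = sing_val B (Suc i)" for i
  define diag where "diag f = mat_diag q (\<lambda>i. complex_of_real (f i))" for f
  have V: "unitary q V" and gram: "adj (B * V) * (B * V) = diag (\<lambda>i. (s i)\<^sup>2)"
    using rsb B by (auto simp: right_singular_basis_def diag_def s_def)
  note Vc = unitaryD[OF V]
  have dg: "diag f \<in> carrier_mat q q" "adj (diag f) = diag f" for f
    by (simp_all add: diag_def)
  have dgd: "dim_row (diag f) = q" "dim_col (diag f) = q" for f
    by (simp_all add: diag_def mat_diag_def)
  have dm: "diag f * diag g = diag (\<lambda>i. f i * g i)" for f g
    by (simp add: diag_def)
  have dims: "dim_row V = q" "dim_col V = q" "dim_row B = p" "dim_col B = q"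
    using Vc B by auto
  note simps = assoc_mult_mat' adj_mult' unitary_cancel[OF V] dims dg dgd dm
  have gramB: "adj B * B = V * diag (\<lambda>i. (s i)\<^sup>2) * adj V"
    unfolding gram[symmetric] using Vc by (simp add: simps)
  \<comment> \<open>\<open>G\<close> is the pseudoinverse of \<open>B\<^sup>* B\<close>, and \<open>P\<close> the orthogonal projection onto the range of \<open>B\<^sup>*\<close>.\<close>
  define G where "G = V * diag (\<lambda>i. 1 / (s i)\<^sup>2) * adj V"
  define P where "P = V * diag (\<lambda>i. if s i = 0 then 0 else 1) * adj V"
  have dGP: "dim_row G = q" "dim_col G = q" "dim_row P = q" "dim_col P = q"
    by (simp_all add: G_def P_def simps)
  have adjG: "adj G = G" and adjP: "adj P = P"
    by (simp_all add: G_def P_def simps)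
  have if1: "(\<lambda>i. 1 / (s i)\<^sup>2 * (s i)\<^sup>2) = (\<lambda>i. if s i = 0 then 0 else 1)"
    "(\<lambda>i. (if s i = 0 then 0 else 1) * (1 / (s i)\<^sup>2)) = (\<lambda>i. 1 / (s i)\<^sup>2)"
    "(\<lambda>i. (s i)\<^sup>2 * (if s i = 0 then 0 else 1)) = (\<lambda>i. (s i)\<^sup>2)"
    by (auto simp: fun_eq_iff)
  have GB: "G * (adj B * B) = P"
  proof -
    have "G * (adj B * B) = V * (diag (\<lambda>i. 1 / (s i)\<^sup>2) * diag (\<lambda>i. (s i)\<^sup>2)) * adj V"
      unfolding gramB G_def by (simp add: assoc_mult_mat' unitary_cancel[OF V] dims dg dgd)
    then show ?thesis unfolding P_def dm if1 .
  qed
  have PG: "P * G = G"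
  proof -
    have "P * G = V * (diag (\<lambda>i. if s i = 0 then 0 else 1) * diag (\<lambda>i. 1 / (s i)\<^sup>2)) * adj V"
      unfolding P_def G_def by (simp add: assoc_mult_mat' unitary_cancel[OF V] dims dg dgd)
    then show ?thesis unfolding G_def dm if1 .
  qed
  have gramP: "adj B * B * P = adj B * B"
  proof -
    have "adj B * B * P = V * (diag (\<lambda>i. (s i)\<^sup>2) * diag (\<lambda>i. if s i = 0 then 0 else 1)) * adj V"
      unfolding gramB P_def by (simp add: assoc_mult_mat' unitary_cancel[OF V] dims dg dgd)
    then show ?thesis unfolding gramB dm if1 .
  qed
  have BP: "B * P = B"
  proof -
    define N where "N = B - B * P"
    have N: "N \<in> carrier_mat p q" using dims dGP by (intro carrier_matI) (simp_all add: N_def)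
    have M: "adj B * B \<in> carrier_mat q q" "adj B * N \<in> carrier_mat q q"
      using dims N by (auto intro!: carrier_matI)
    have "adj B * N = adj B * B - adj B * B * P"
      unfolding N_def using dims dGP by (simp add: mult_minus_distrib_mat' assoc_mult_mat')
    also have "\<dots> = 0\<^sub>m q q" unfolding gramP by (rule minus_r_inv_mat[OF M(1)])
    finally have BN: "adj B * N = 0\<^sub>m q q" .
    have "adj N = adj B - P * adj B"
    proof -
      have "adj (B * P) = P * adj B" using dims dGP by (simp add: adj_mult' adjP)
      moreover have "B * P \<in> carrier_mat p q" using dims dGP by (intro carrier_matI) simp_all
      ultimately show ?thesis unfolding N_def by (simp add: adj_minus[OF B])
    qed
    then have "adj N * N = adj B * N - P * (adj B * N)"
      using dims dGP carrier_matD[OF N] by (simp add: minus_mult_distrib_mat' assoc_mult_mat')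
    also have "\<dots> = 0\<^sub>m q q"
    proof -
      have "P * 0\<^sub>m q q = (0\<^sub>m q q :: complex mat)"
        using dGP by (intro right_mult_zero_mat carrier_matI)
      then show ?thesis unfolding BN by (simp only: minus_r_inv_mat[OF zero_carrier_mat])
    qed
    finally have N0: "N = 0\<^sub>m p q" by (rule mat_eq_0_if_adj_mult_self_eq_0[OF N])
    show ?thesis
    proof (rule eq_matI)
      fix i j assume ij: "i < dim_row B" "j < dim_col B"
      have "N $$ (i, j) = B $$ (i, j) - (B * P) $$ (i, j)"
        unfolding N_def using ij dims dGP by (intro index_minus_mat) simp_all
      moreover have "N $$ (i, j) = 0" unfolding N0 using ij dims by simp
      ultimately show "(B * P) $$ (i, j) = B $$ (i, j)" by simp
    qed (use dims dGP in auto)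
  qed
  define X where "X = G * adj B"
  have XB: "X * B = P" unfolding X_def GB[symmetric] using dims dGP by (simp add: assoc_mult_mat')
  have "is_pinv B X"
    unfolding is_pinv_def
  proof (intro conjI)
    show "X \<in> carrier_mat (dim_col B) (dim_row B)" using dims dGP by (intro carrier_matI) (auto simp: X_def)
    then have dX: "dim_row X = q" "dim_col X = p" using dims by auto
    show "B * X * B = B" using dims dX by (simp add: assoc_mult_mat' XB BP)
    show "X * B * X = X" unfolding XB using dims dGP PG by (simp add: X_def flip: assoc_mult_mat')
    show "adj (B * X) = B * X" using dims dGP by (simp add: X_def adj_mult' assoc_mult_mat' adjG)
    show "adj (X * B) = X * B" unfolding XB by (rule adjP)
  qed
  then have pinv: "pinv B = X" by (rule pinv_eqI)
  then show "is_pinv B (pinv B)" using \<open>is_pinv B X\<close> by simp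
  have "(\<lambda>i. if s i = 0 then 0 else 1) = (\<lambda>i. if i < mrank B then 1 else 0 :: real)"
    using sing_val_pos_iff[of B] sing_val_nonneg[of B] by (force simp: fun_eq_iff s_def less_le)
  then show "pinv B * B = V * mat_diag q (\<lambda>i. complex_of_real (if i < mrank B then 1 else 0)) * adj V"
    unfolding pinv XB P_def diag_def by metis
qed

lemma pinv_props:
  assumes "B \<in> carrier_mat p q"
  shows "pinv B \<in> carrier_mat q p" "B * pinv B * B = B" "pinv B * B * pinv B = pinv B"
    "adj (B * pinv B) = B * pinv B" "adj (pinv B * B) = pinv B * B"
proof -
  obtain V where "right_singular_basis B V (\<lambda>i. sing_val B (Suc i))" by (rule sing_val_basis[of B])
  from pinv_singular(1)[OF assms this] assms
  show "pinv B \<in> carrier_mat q p" "B * pinv B * B = B" "pinv B * B * pinv B = pinv B"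
    "adj (B * pinv B) = B * pinv B" "adj (pinv B * B) = pinv B * B"
    by (auto simp: is_pinv_def)
qed

lemma pinv_left_inverse:
  assumes B: "B \<in> carrier_mat p q" and full: "mrank B = q"
  shows "pinv B * B = 1\<^sub>m q"
proof -
  obtain V where rsb: "right_singular_basis B V (\<lambda>i. sing_val B (Suc i))" by (rule sing_val_basis[of B])
  then have "unitary q V" using B by (simp add: right_singular_basis_def)
  note Vc = unitaryD[OF this]
  have "mat_diag q (\<lambda>i. complex_of_real (if i < mrank B then 1 else 0)) = 1\<^sub>m q"
    unfolding full by (intro eq_matI) (auto simp: mat_diag_def)
  then show ?thesis using pinv_singular(2)[OF B rsb] Vc by simp
qed

text \<open>Pythagoras for the complementary projections \<open>P\<close> and \<open>N = 1 - P\<close>.\<close>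

lemma sqnorm_projection_le:
  assumes P: "P \<in> carrier_mat n n" and idem: "P * P = P" and herm: "adj P = P"
    and x: "x \<in> carrier_vec n"
  shows "sqnorm (P *\<^sub>v x) \<le> sqnorm x"
proof -
  define N where "N = 1\<^sub>m n - P"
  have N: "N \<in> carrier_mat n n" using P by (auto simp: N_def)
  have "adj N * N = N"
    using P by (simp add: N_def adj_minus[of _ n n] herm minus_mult_distrib_mat' mult_minus_distrib_mat' idem)
      (auto intro!: eq_matI)
  then have "complex_of_real (sqnorm (P *\<^sub>v x) + sqnorm (N *\<^sub>v x)) =
    (\<Sum>i<n. \<Sum>j<n. cnj (x $ i) * P $$ (i, j) * x $ j) + (\<Sum>i<n. \<Sum>j<n. cnj (x $ i) * N $$ (i, j) * x $ j)"
    using sqnorm_mult_vec[OF P x] sqnorm_mult_vec[OF N x] by (simp add: idem herm)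
  also have "\<dots> = (\<Sum>i<n. \<Sum>j<n. cnj (x $ i) * (adj (1\<^sub>m n) * 1\<^sub>m n) $$ (i, j) * x $ j)"
    unfolding sum.distrib[symmetric] using P by (intro sum.cong refl) (auto simp: N_def algebra_simps)
  also have "\<dots> = complex_of_real (sqnorm (1\<^sub>m n *\<^sub>v x))"
    by (rule sqnorm_mult_vec[OF one_carrier_mat x, symmetric])
  finally have "sqnorm (P *\<^sub>v x) + sqnorm (N *\<^sub>v x) = sqnorm x"
    using x by (simp only: of_real_eq_iff one_mult_mat_vec)
  then show ?thesis using sqnorm_nonneg[of "N *\<^sub>v x"] by linarith
qed

text \<open>On the range of \<open>B\<^sup>\<dagger>\<close>, which is that of \<open>B\<^sup>*\<close>, the matrix \<open>B\<close> stretches by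
  at least its last nonzero singular value, while \<open>B B\<^sup>\<dagger>\<close> is a projection.\<close>

lemma sing_val_mult_spectral_norm_pinv_le_1:
  assumes B: "B \<in> carrier_mat p q" and k: "mrank B = Suc k"
  shows "sing_val B (Suc k) * spectral_norm (pinv B) \<le> 1"
proof -
  let ?X = "pinv B"
  note X = pinv_props[OF B]
  obtain V where rsb: "right_singular_basis B V (\<lambda>i. sing_val B (Suc i))" by (rule sing_val_basis[of B])
  obtain Z where rsbX: "right_singular_basis ?X Z (\<lambda>i. sing_val ?X (Suc i))" by (rule sing_val_basis[of ?X])
  note V = right_singular_basis_unitary[OF rsb B] and Z = right_singular_basis_unitary[OF rsbX X(1)]
  note Vc = unitaryD[OF V] and Zc = unitaryD[OF Z]
  have p: "0 < p" using mrank_le_dim(1)[OF B] k by simp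
  define y where "y = Z *\<^sub>v unit_vec p 0"
  have y: "y \<in> carrier_vec p" using Zc by (simp add: y_def)
  have y1: "sqnorm y = 1"
  proof -
    have "sqnorm y = sqnorm (unit_vec p 0)"
      unfolding y_def using Zc by (intro sqnorm_isometry) auto
    also have "\<dots> = (\<Sum>i<p. if i = 0 then 1 else 0)" unfolding sqnorm_def by (rule sum.cong) auto
    finally show ?thesis using p by simp
  qed
  define x where "x = ?X *\<^sub>v y"
  have x: "x \<in> carrier_vec q" using X(1) y by (simp add: x_def)
  have Zy: "adj Z *\<^sub>v y = unit_vec p 0"
    using assoc_mult_mat_vec[OF Zc(2,1) unit_vec_carrier, of 0] Zc by (simp add: y_def)
  have "(sing_val ?X (Suc 0))\<^sup>2 * sqnorm y \<le> sqnorm x"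
    unfolding x_def by (rule sqnorm_mult_vec_ge[OF X(1) y rsbX]) (simp add: Zy)
  then have sx: "(spectral_norm ?X)\<^sup>2 \<le> sqnorm x" by (simp add: y1 spectral_norm_def)
  define D where "D = mat_diag q (\<lambda>i. complex_of_real (if i < mrank B then 1 else 0))"
  have D: "D \<in> carrier_mat q q" by (simp add: D_def)
  have XB: "?X * B \<in> carrier_mat q q" using X(1) B by simp
  have "x = (?X * B) *\<^sub>v x"
    unfolding x_def using assoc_mult_mat_vec[OF XB X(1) y] by (simp only: X(3))
  then have "adj V *\<^sub>v x = (adj V * (?X * B)) *\<^sub>v x"
    using assoc_mult_mat_vec[OF Vc(2) XB x] by argo
  also have "adj V * (?X * B) = adj V * (V * D * adj V)"
    unfolding pinv_singular(2)[OF B rsb] D_def ..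
  also have "\<dots> = D * adj V"
    using Vc D by (simp add: assoc_mult_mat' unitary_cancel[OF V])
  finally have Vx: "adj V *\<^sub>v x = (D * adj V) *\<^sub>v x" .
  have "(adj V *\<^sub>v x) $ j = 0" if j: "k < j" "j < q" for j
    unfolding Vx mult_vec_index[OF mult_carrier_mat[OF D Vc(2)] x j(2)]
    unfolding D_def mat_diag_mult_left[OF Vc(2)]
    using j k by (intro sum.neutral) auto
  then have "(sing_val B (Suc k))\<^sup>2 * sqnorm x \<le> sqnorm (B *\<^sub>v x)"
    by (intro sqnorm_mult_vec_ge[OF B x rsb])
  also have "B *\<^sub>v x = (B * ?X) *\<^sub>v y"
    unfolding x_def using assoc_mult_mat_vec[OF B X(1) y] by simp
  also have "sqnorm \<dots> \<le> sqnorm y"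
  proof (rule sqnorm_projection_le[OF mult_carrier_mat[OF B X(1)] _ X(4) y])
    have "B * ?X * (B * ?X) = B * ?X * B * ?X" using B X(1) by (simp add: assoc_mult_mat')
    then show "B * ?X * (B * ?X) = B * ?X" by (simp only: X(2))
  qed
  finally have "(sing_val B (Suc k))\<^sup>2 * sqnorm x \<le> 1" by (simp add: y1)
  moreover have "(sing_val B (Suc k))\<^sup>2 * (spectral_norm ?X)\<^sup>2 \<le> (sing_val B (Suc k))\<^sup>2 * sqnorm x"
    using sx by (intro mult_left_mono) auto
  ultimately have "(sing_val B (Suc k) * spectral_norm ?X)\<^sup>2 \<le> 1" by (simp add: power_mult_distrib)
  then show ?thesis using power2_le_imp_le[of "sing_val B (Suc k) * spectral_norm ?X" 1] by simp
qed

section \<open>Matrices over the ground field\<close>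

lemma kmats_iff: "B \<in> kmats K p q \<longleftrightarrow> B \<in> carrier_mat p q \<and> (\<forall>i<p. \<forall>j<q. B $$ (i, j) \<in> K)"
  unfolding kmats_def subset_iff by (auto dest!: elements_matD)

lemma kmats_carrier: "B \<in> kmats K p q \<Longrightarrow> B \<in> carrier_mat p q"
  by (simp add: kmats_iff)

locale ground_field =
  fixes K :: "complex set"
  assumes ground: "K = \<real> \<or> K = UNIV"
begin

lemma field_closed:
  "complex_of_real r \<in> K" "0 \<in> K" "1 \<in> K" "a \<in> K \<Longrightarrow> b \<in> K \<Longrightarrow> a + b \<in> K" "a \<in> K \<Longrightarrow> b \<in> K \<Longrightarrow> a - b \<in> K"
  "a \<in> K \<Longrightarrow> b \<in> K \<Longrightarrow> a * b \<in> K" "a \<in> K \<Longrightarrow> - a \<in> K" "a \<in> K \<Longrightarrow> cnj a \<in> K"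
  using ground by (auto simp: Reals_cnj_iff)

lemma field_sum_closed: "(\<And>i. i \<in> S \<Longrightarrow> f i \<in> K) \<Longrightarrow> sum f S \<in> K"
  by (induction S rule: infinite_finite_induct) (auto intro: field_closed)

lemma kmats_mult:
  assumes "A \<in> kmats K p q" "B \<in> kmats K q r"
  shows "A * B \<in> kmats K p r"
  unfolding kmats_iff
proof (intro conjI allI impI)
  have A: "A \<in> carrier_mat p q" "\<And>i l. i < p \<Longrightarrow> l < q \<Longrightarrow> A $$ (i, l) \<in> K"
    and B: "B \<in> carrier_mat q r" "\<And>l j. l < q \<Longrightarrow> j < r \<Longrightarrow> B $$ (l, j) \<in> K"
    using assms by (simp_all add: kmats_iff)
  show "A * B \<in> carrier_mat p r" by (rule mult_carrier_mat[OF A(1) B(1)])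
  show "(A * B) $$ (i, j) \<in> K" if "i < p" "j < r" for i j
    unfolding mult_index[OF A(1) B(1) that] using that
    by (intro field_sum_closed field_closed(6) A(2) B(2)) simp_all
qed

lemma kmats_add: "A \<in> kmats K p q \<Longrightarrow> B \<in> kmats K p q \<Longrightarrow> A + B \<in> kmats K p q"
  and kmats_minus: "A \<in> kmats K p q \<Longrightarrow> B \<in> kmats K p q \<Longrightarrow> A - B \<in> kmats K p q"
  and kmats_uminus: "A \<in> kmats K p q \<Longrightarrow> - A \<in> kmats K p q"
  and kmats_smult: "A \<in> kmats K p q \<Longrightarrow> c \<in> K \<Longrightarrow> c \<cdot>\<^sub>m A \<in> kmats K p q"
  and kmats_adj: "A \<in> kmats K p q \<Longrightarrow> adj A \<in> kmats K q p"
  and kmats_one: "1\<^sub>m n \<in> kmats K n n"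
  by (auto simp: kmats_iff field_closed)

lemma kmats_mat:
  "(\<And>i j. i < p \<Longrightarrow> j < q \<Longrightarrow> f (i, j) \<in> K) \<Longrightarrow> mat p q f \<in> kmats K p q"
  by (auto simp: kmats_iff)

lemma kmats_submatrix:
  assumes "A \<in> kmats K p q"
  shows "submatrix A I J \<in> kmats K (card {i. i < p \<and> i \<in> I}) (card {j. j < q \<and> j \<in> J})"
  using assms pick_le by (auto simp: kmats_iff submatrix_def)

text \<open>The Penrose equations of a real matrix have real coefficients, so that the entrywise conjugate
  of their solution is again the solution.\<close>

lemma kmats_pinv:
  assumes B: "B \<in> kmats K p q"
  shows "pinv B \<in> kmats K q p"
proof (cases "K = UNIV")
  case True
  then show ?thesis using pinv_props(1)[OF kmats_carrier[OF B]] by (simp add: kmats_iff)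
next
  case False
  then have K: "K = \<real>" using ground by simp
  have Bc: "B \<in> carrier_mat p q" using B by (rule kmats_carrier)
  note X = pinv_props[OF Bc]
  let ?c = "map_mat cnj"
  interpret cnj: comm_ring_hom cnj by unfold_locales auto
  have adj: "adj (?c A) = ?c (adj A)" for A by (rule eq_matI) auto
  have cB: "?c B = B" using B K by (intro eq_matI) (auto simp: kmats_iff Reals_cnj_iff)
  have BX: "B * ?c (pinv B) = ?c (B * pinv B)"
    using cnj.mat_hom_mult[OF Bc X(1)] by (simp add: cB)
  have XB: "?c (pinv B) * B = ?c (pinv B * B)"
    using cnj.mat_hom_mult[OF X(1) Bc] by (simp add: cB)
  have "is_pinv B (?c (pinv B))"
    unfolding is_pinv_def
  proof (intro conjI)
    show "?c (pinv B) \<in> carrier_mat (dim_col B) (dim_row B)" using X(1) Bc by simp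
    show "B * ?c (pinv B) * B = B"
      unfolding BX using cnj.mat_hom_mult[OF mult_carrier_mat[OF Bc X(1)] Bc] by (simp add: cB X)
    show "?c (pinv B) * B * ?c (pinv B) = ?c (pinv B)"
      unfolding XB using cnj.mat_hom_mult[OF mult_carrier_mat[OF X(1) Bc] X(1)] by (simp add: X)
    show "adj (B * ?c (pinv B)) = B * ?c (pinv B)" unfolding BX adj X ..
    show "adj (?c (pinv B) * B) = ?c (pinv B) * B" unfolding XB adj X ..
  qed
  then have "pinv B = ?c (pinv B)" by (rule pinv_eqI)
  then have "pinv B $$ (i, j) = cnj (pinv B $$ (i, j))" if "i < q" "j < p" for i j
    using that X(1) by (metis carrier_matD index_map_mat(1))
  then show ?thesis using X(1) K by (auto simp: kmats_iff Reals_cnj_iff)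
qed

end

section \<open>Rectangular diagonal matrices\<close>

definition rdiag :: "nat \<Rightarrow> nat \<Rightarrow> (nat \<Rightarrow> real) \<Rightarrow> complex mat" where
  "rdiag p q f = mat p q (\<lambda>(i, j). if i = j then complex_of_real (f i) else 0)"

lemma rdiag_carrier [simp]:
  "rdiag p q f \<in> carrier_mat p q" "dim_row (rdiag p q f) = p" "dim_col (rdiag p q f) = q"
  by (auto simp: rdiag_def)

lemma rdiag_index [simp]:
  "i < p \<Longrightarrow> j < q \<Longrightarrow> rdiag p q f $$ (i, j) = (if i = j then complex_of_real (f i) else 0)"
  by (simp add: rdiag_def)

lemma (in ground_field) rdiag_kmats: "rdiag p q f \<in> kmats K p q"
  unfolding rdiag_def by (rule kmats_mat) (auto intro: field_closed)

lemma gram_rdiag: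
  "adj (rdiag p q f) * rdiag p q f = mat_diag q (\<lambda>i. complex_of_real ((if i < p then f i else 0)\<^sup>2))"
proof (rule eq_matI)
  fix i j assume "i < dim_row (mat_diag q (\<lambda>i. complex_of_real ((if i < p then f i else 0)\<^sup>2)))"
    "j < dim_col (mat_diag q (\<lambda>i. complex_of_real ((if i < p then f i else 0)\<^sup>2)))"
  then have ij: "i < q" "j < q" by (auto simp: mat_diag_def)
  have "(adj (rdiag p q f) * rdiag p q f) $$ (i, j) =
    (\<Sum>l<p. adj (rdiag p q f) $$ (i, l) * rdiag p q f $$ (l, j))"
    by (rule mult_index[OF adj_carrier[OF rdiag_carrier(1)] rdiag_carrier(1) ij])
  also have "\<dots> = (\<Sum>l<p. if l = i then (if i = j then complex_of_real ((f i)\<^sup>2) else 0) else 0)"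
    by (rule sum.cong) (use ij in \<open>auto simp: power2_eq_square\<close>)
  finally show "(adj (rdiag p q f) * rdiag p q f) $$ (i, j) =
    mat_diag q (\<lambda>i. complex_of_real ((if i < p then f i else 0)\<^sup>2)) $$ (i, j)"
    using ij by (auto simp: mat_diag_def)
qed (auto simp: mat_diag_def)

text \<open>The values \<open>f\<close> may come in any order here, as is the case for the difference of a matrix and its truncated
  singular value decomposition.\<close>

lemma right_singular_basis_rdiag:
  assumes W: "unitary p W" and V: "unitary q V" and f: "\<And>i. 0 \<le> f i"
  shows "right_singular_basis (W * rdiag p q f * adj V) V (\<lambda>i. if i < p then f i else 0)"
proof -
  note Wc = unitaryD[OF W] and Vc = unitaryD[OF V]
  have "W * rdiag p q f * adj V * V = W * rdiag p q f"
    using Wc Vc by (simp add: assoc_mult_mat')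
  moreover have "adj (W * rdiag p q f) * (W * rdiag p q f) = adj (rdiag p q f) * rdiag p q f"
    using Wc by (simp add: assoc_mult_mat' adj_mult' unitary_cancel[OF W])
  ultimately show ?thesis
    using V Vc f by (simp add: right_singular_basis_def gram_rdiag)
qed

lemma sing_val_rdiag:
  assumes W: "unitary p W" and V: "unitary q V" and f: "\<And>i. 0 \<le> f i"
    and dec: "\<And>i j. i \<le> j \<Longrightarrow> f j \<le> f i"
  shows "sing_val (W * rdiag p q f * adj V) (Suc i) = (if i < p \<and> i < q then f i else 0)"
proof -
  have "sing_val (W * rdiag p q f * adj V) (Suc i) =
    (if i < dim_col (W * rdiag p q f * adj V) then if i < p then f i else 0 else 0)"
    by (rule right_singular_basis_sing_val[OF right_singular_basis_rdiag[OF W V f]])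
       (use f dec in auto)
  then show ?thesis using unitaryD[OF V] by auto
qed

lemma sing_vals_cong:
  assumes "dim_row B = dim_row C" "dim_col B = dim_col C" "sing_mset B = sing_mset C"
  shows "sing_vals B = sing_vals C"
  unfolding sing_vals_def assms ..

lemma sigma_mat_eq_rdiag:
  "sigma_mat B t = rdiag (dim_row B) (dim_col B) (\<lambda>i. if i < t then sing_val B (Suc i) else 0)"
  "sigma_mat B (min (dim_row B) (dim_col B)) = rdiag (dim_row B) (dim_col B) (\<lambda>i. sing_val B (Suc i))"
  by (auto simp: sigma_mat_def rdiag_def intro!: eq_matI)

lemma svd_rdiag:
  assumes "svd K B W V" "B \<in> carrier_mat p q"
  shows "unitary p W" "unitary q V" "B = W * rdiag p q (\<lambda>i. sing_val B (Suc i)) * adj V"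
proof -
  show "unitary p W" "unitary q V"
    using assms by (auto simp: svd_def unitary_mats_def unitary_def kmats_def)
  have "B = W * sigma_mat B (min (dim_row B) (dim_col B)) * adj V"
    using assms(1) unfolding svd_def by blast
  then show "B = W * rdiag p q (\<lambda>i. sing_val B (Suc i)) * adj V"
    unfolding sigma_mat_eq_rdiag(2) using assms(2) by simp
qed

section \<open>Unitarily invariant norms\<close>

locale ui_norm = uniform_norm K nrm + ground_field K for K nrm
begin

text \<open>Uniform generation compares matrices of different sizes; the rank, at which the list of singular values
  is cut, is itself determined by the singular values.\<close>

lemma nrm_cong_sing_val:
  assumes B: "B \<in> kmats K p q" "1 \<le> p" "1 \<le> q" and C: "C \<in> kmats K p' q'" "1 \<le> p'" "1 \<le> q'"
    and eq: "\<And>i. sing_val B (Suc i) = sing_val C (Suc i)"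
  shows "nrm B = nrm C"
proof -
  obtain \<phi> where \<phi>: "\<And>p q B. 1 \<le> p \<Longrightarrow> 1 \<le> q \<Longrightarrow> B \<in> kmats K p q \<Longrightarrow>
    nrm B = \<phi> (map (sing_val B) [1..<Suc (mrank B)])"
    using uniformly_generated by blast
  have rank: "mrank B = mrank C" by (simp add: mrank_eq_card_sing_val eq)
  have vals: "map (sing_val B) [1..<Suc r] = map (sing_val C) [1..<Suc r]" for r
  proof (rule map_cong[OF refl])
    fix i assume "i \<in> set [1..<Suc r]"
    then have "i \<noteq> 0" by auto
    then obtain l where "i = Suc l" by (cases i) auto
    then show "sing_val B i = sing_val C i" by (simp only: eq)
  qed
  show ?thesis unfolding \<phi>[OF B(2,3,1)] \<phi>[OF C(2,3,1)] rank vals ..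
qed

lemma nrm_cong_gram:
  assumes "B \<in> kmats K p q" "C \<in> kmats K p' q" "1 \<le> p" "1 \<le> p'" "1 \<le> q" "adj B * B = adj C * C"
  shows "nrm B = nrm C"
proof (rule nrm_cong_sing_val[OF assms(1,3,5) assms(2,4,5)])
  show "sing_val B (Suc i) = sing_val C (Suc i)" for i
    using kmats_carrier[OF assms(1)] kmats_carrier[OF assms(2)] assms(6)
    by (intro sing_val_cong_gram) auto
qed

lemma nrm_adj:
  assumes "B \<in> kmats K p q" "1 \<le> p" "1 \<le> q"
  shows "nrm (adj B) = nrm B"
  using assms by (intro nrm_cong_sing_val[of _ q p _ p q] kmats_adj) (auto simp: sing_val_adj)

lemma nrm_uminus:
  assumes "B \<in> kmats K p q" "1 \<le> p" "1 \<le> q"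
  shows "nrm (- B) = nrm B"
proof -
  have "- B = (- 1) \<cdot>\<^sub>m B" by (rule eq_matI) auto
  then show ?thesis using homogeneous[OF assms(2,3,1), of "- 1"] by (simp add: field_closed)
qed

lemma nrm_minus_le:
  assumes "B \<in> kmats K p q" "C \<in> kmats K p q" "1 \<le> p" "1 \<le> q"
  shows "nrm (B - C) \<le> nrm B + nrm C"
proof -
  have "B - C = B + - C"
    by (rule eq_matI) (use kmats_carrier[OF assms(1)] kmats_carrier[OF assms(2)] in auto)
  then show ?thesis
    using triangle[OF assms(3,4,1) kmats_uminus[OF assms(2)]] nrm_uminus[OF assms(2,3,4)] by simp
qed

text \<open>\<open>W X\<close> and \<open>X\<close> have the same Gram matrix.\<close>

lemma nrm_isometry:
  assumes W: "W \<in> kmats K p r" "adj W * W = 1\<^sub>m r" and X: "X \<in> kmats K r q"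
    and "1 \<le> p" "1 \<le> q" "1 \<le> r"
  shows "nrm (W * X) = nrm X"
proof (rule nrm_cong_gram[OF kmats_mult[OF W(1) X] X])
  have d: "dim_row W = p" "dim_col W = r" "dim_row X = r" "dim_col X = q"
    using kmats_carrier[OF W(1)] kmats_carrier[OF X] by auto
  have "adj (W * X) * (W * X) = adj X * (adj W * W * X)"
    using d by (simp add: adj_mult' assoc_mult_mat')
  then show "adj (W * X) * (W * X) = adj X * X" using W(2) kmats_carrier[OF X] by simp
qed fact+

text \<open>A projection \<open>P\<close> is the mean of the identity and the reflection \<open>2 P - 1\<close>, which is unitary.\<close>

lemma nrm_projection_mult_le:
  assumes P: "P \<in> kmats K p p" "P * P = P" "adj P = P" and X: "X \<in> kmats K p q"
    and p: "1 \<le> p" and q: "1 \<le> q"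
  shows "nrm (P * X) \<le> nrm X"
proof -
  define R where "R = P - (1\<^sub>m p - P)"
  have Pc: "P \<in> carrier_mat p p" and Xc: "X \<in> carrier_mat p q"
    using P X by (auto dest: kmats_carrier)
  have R: "R \<in> kmats K p p" unfolding R_def by (intro kmats_minus kmats_one P)
  have Rc: "R \<in> carrier_mat p p" using R by (rule kmats_carrier)
  have "adj R = R"
    using Pc by (simp add: R_def adj_minus[of _ p p] P minus_carrier_mat)
  moreover have "R * R = 1\<^sub>m p"
    using Pc unfolding R_def
    by (simp add: minus_mult_distrib_mat' mult_minus_distrib_mat' P(2)) (auto intro!: eq_matI)
  ultimately have "adj R * R = 1\<^sub>m p" by simp
  then have RX: "nrm (R * X) = nrm X" using R X p q by (intro nrm_isometry)
  have "P * X = complex_of_real (1/2) \<cdot>\<^sub>m (X + R * X)"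
  proof -
    have "R * X = P * X - (X - P * X)"
      using Pc Xc by (simp add: R_def minus_mult_distrib_mat')
    then show ?thesis using Pc Xc by (intro eq_matI) (auto simp del: index_mult_mat(1))
  qed
  then have "nrm (P * X) = 1/2 * nrm (X + R * X)"
    using homogeneous[OF p q kmats_add[OF X kmats_mult[OF R X]], of "complex_of_real (1/2)"]
    by (simp add: field_closed del: of_real_divide)
  also have "\<dots> \<le> nrm X"
    using triangle[OF p q X kmats_mult[OF R X]] RX by simp
  finally show ?thesis .
qed

lemma nrm_mult_projection_le:
  assumes P: "P \<in> kmats K q q" "P * P = P" "adj P = P" and X: "X \<in> kmats K p q"
    and p: "1 \<le> p" and q: "1 \<le> q"
  shows "nrm (X * P) \<le> nrm X"
proof -
  have "adj (P * adj X) = X * P"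
    using kmats_carrier[OF P(1)] kmats_carrier[OF X] P(3) by (simp add: adj_mult')
  then show ?thesis
    using nrm_projection_mult_le[OF P kmats_adj[OF X] q p] nrm_adj[OF X p q]
      nrm_adj[OF kmats_mult[OF P(1) kmats_adj[OF X]] q p] by simp
qed

lemma nrm_eq_nrm_rdiag:
  assumes B: "B \<in> kmats K p q" and "1 \<le> p" "1 \<le> q"
  shows "nrm B = nrm (rdiag p q (\<lambda>i. sing_val B (Suc i)))"
proof (rule nrm_cong_sing_val[OF B _ _ rdiag_kmats])
  fix i
  have "1\<^sub>m p * rdiag p q (\<lambda>i. sing_val B (Suc i)) * adj (1\<^sub>m q) = rdiag p q (\<lambda>i. sing_val B (Suc i))"
    by (simp add: left_mult_one_mat[OF rdiag_carrier(1)] right_mult_one_mat[OF rdiag_carrier(1)])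
  then show "sing_val B (Suc i) = sing_val (rdiag p q (\<lambda>i. sing_val B (Suc i))) (Suc i)"
    using sing_val_rdiag[OF unitary_one[of p] unitary_one[of q], of "\<lambda>i. sing_val B (Suc i)" i]
      sing_val_nonneg[of B] sing_val_antimono[of _ _ B]
      sing_val_eq_0[of B i] kmats_carrier[OF B] by auto
qed (use assms in auto)

text \<open>For the diagonal matrix of the singular values, the first unit vector \<open>e\<close> attains the spectral
  norm. Submultiplicativity bounds the Euclidean norm of its image, because the norm of vectors is
  normalized. No eigenvector of \<open>B\<^sup>* B\<close> is involved, so \<open>e\<close> has entries in \<open>K\<close>.\<close>

lemma spectral_norm_le_nrm:
  assumes B: "B \<in> kmats K p q" and p: "1 \<le> p" and q: "1 \<le> q"
  shows "spectral_norm B \<le> nrm B"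
proof -
  let ?s = "\<lambda>i. sing_val B (Suc i)"
  let ?D = "rdiag p q ?s"
  define e where "e = mat q 1 (\<lambda>(i, j). if i = 0 then 1 else 0 :: complex)"
  have e: "e \<in> kmats K q 1" unfolding e_def by (rule kmats_mat) (auto intro: field_closed)
  have D: "?D \<in> kmats K p q" by (rule rdiag_kmats)
  have "nrm e = sqrt (\<Sum>i<q. (cmod (e $$ (i, 0)))\<^sup>2)" by (rule normalized[OF q e])
  also have "(\<Sum>i<q. (cmod (e $$ (i, 0)))\<^sup>2) = (\<Sum>i<q. if i = 0 then 1 else 0)"
    by (rule sum.cong) (auto simp: e_def)
  finally have ne: "nrm e = 1" using q by simp
  have "nrm (?D * e) = sqrt (\<Sum>i<p. (cmod ((?D * e) $$ (i, 0)))\<^sup>2)"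
    by (rule normalized[OF p kmats_mult[OF D e]])
  also have "(\<Sum>i<p. (cmod ((?D * e) $$ (i, 0)))\<^sup>2) = (\<Sum>i<p. if i = 0 then (spectral_norm B)\<^sup>2 else 0)"
  proof (rule sum.cong[OF refl])
    fix i assume "i \<in> {..<p}"
    then have i: "i < p" by simp
    have "(?D * e) $$ (i, 0) = (\<Sum>l<q. ?D $$ (i, l) * e $$ (l, 0))"
      using kmats_carrier[OF D] kmats_carrier[OF e] i by (intro mult_index) auto
    also have "\<dots> = (\<Sum>l<q. if l = 0 then ?D $$ (i, 0) else 0)"
      by (rule sum.cong) (auto simp: e_def)
    also have "\<dots> = (if i = 0 then complex_of_real (spectral_norm B) else 0)"
      using q i by (simp add: spectral_norm_def)
    finally show "(cmod ((?D * e) $$ (i, 0)))\<^sup>2 = (if i = 0 then (spectral_norm B)\<^sup>2 else 0)" by simp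
  qed
  finally have "nrm (?D * e) = spectral_norm B"
    using p sing_val_nonneg[of B 0] by (simp add: spectral_norm_def)
  then show ?thesis
    using submultiplicative[OF p q _ D e] ne nrm_eq_nrm_rdiag[OF B p q] by simp
qed

text \<open>Shrinking the entry \<open>t\<close> by the factor \<open>c\<close> gives a convex combination of the original matrix and its
  copy with the sign of this entry flipped. The copy has the same norm, because its Gram matrix is the
  same.\<close>

lemma nrm_rdiag_shrink_entry:
  assumes c: "0 \<le> c" "c \<le> 1" and p: "1 \<le> p" and q: "1 \<le> q"
  shows "nrm (rdiag p q (g(t := c * g t))) \<le> nrm (rdiag p q g)"
proof -
  let ?D = "rdiag p q g" and ?D' = "rdiag p q (g(t := - g t))"
  define a b where "a = (1 + c) / 2" and "b = (1 - c) / 2"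
  have ab: "0 \<le> a" "0 \<le> b" "a + b = 1" "a - b = c"
    using c by (auto simp: a_def b_def field_simps)
  have flip: "nrm ?D' = nrm ?D"
  proof (rule nrm_cong_gram[OF rdiag_kmats rdiag_kmats p p q])
    show "adj ?D' * ?D' = adj ?D * ?D"
      unfolding gram_rdiag by (rule arg_cong[of _ _ "mat_diag q"]) auto
  qed
  have mix: "c * y = a * y + b * (- y)" "y = a * y + b * y" for y
    using ab by (simp_all flip: left_diff_distrib distrib_right)
  have "rdiag p q (g(t := c * g t)) = complex_of_real a \<cdot>\<^sub>m ?D + complex_of_real b \<cdot>\<^sub>m ?D'"
  proof (rule eq_matI)
    fix i j assume "i < dim_row (complex_of_real a \<cdot>\<^sub>m ?D + complex_of_real b \<cdot>\<^sub>m ?D')"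
      "j < dim_col (complex_of_real a \<cdot>\<^sub>m ?D + complex_of_real b \<cdot>\<^sub>m ?D')"
    then have ij: "i < p" "j < q" by auto
    have "complex_of_real (c * g t) = complex_of_real a * complex_of_real (g t) + complex_of_real b * complex_of_real (- g t)"
      "complex_of_real (g i) = complex_of_real a * complex_of_real (g i) + complex_of_real b * complex_of_real (g i)"
      unfolding of_real_mult[symmetric] of_real_add[symmetric] using mix by (simp_all only:)
    then show "rdiag p q (g(t := c * g t)) $$ (i, j) =
      (complex_of_real a \<cdot>\<^sub>m ?D + complex_of_real b \<cdot>\<^sub>m ?D') $$ (i, j)"
      using ij by (cases "i = j"; cases "i = t") (simp_all del: of_real_mult)
  qed auto
  then have "nrm (rdiag p q (g(t := c * g t))) \<le>
      nrm (complex_of_real a \<cdot>\<^sub>m ?D) + nrm (complex_of_real b \<cdot>\<^sub>m ?D')"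
    by (simp only:) (rule triangle[OF p q]; intro kmats_smult rdiag_kmats field_closed(1))
  also have "nrm (complex_of_real a \<cdot>\<^sub>m ?D) = a * nrm ?D"
    using homogeneous[OF p q rdiag_kmats[of p q g] field_closed(1)[of a]] ab by simp
  also have "nrm (complex_of_real b \<cdot>\<^sub>m ?D') = b * nrm ?D"
    using homogeneous[OF p q rdiag_kmats[of p q "g(t := - g t)"] field_closed(1)[of b]] ab flip by simp
  also have "a * nrm ?D + b * nrm ?D = nrm ?D" by (simp only: mix(2)[symmetric])
  finally show ?thesis .
qed

lemma nrm_rdiag_mono:
  assumes fg: "\<And>i. 0 \<le> f i" "\<And>i. f i \<le> g i" and p: "1 \<le> p" and q: "1 \<le> q"
  shows "nrm (rdiag p q f) \<le> nrm (rdiag p q g)"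
proof -
  define h where "h t i = (if i < t then f i else g i)" for t i
  have "nrm (rdiag p q (h t)) \<le> nrm (rdiag p q g)" for t
  proof (induction t)
    case 0
    then show ?case by (simp add: h_def)
  next
    case (Suc t)
    define c where "c = (if g t = 0 then 0 else f t / g t)"
    have c: "0 \<le> c" "c \<le> 1" "c * g t = f t"
      using fg(1)[of t] fg(2)[of t] by (auto simp: c_def divide_le_eq)
    have "h (Suc t) = (h t)(t := c * h t t)"
      using c by (auto simp: h_def fun_eq_iff less_Suc_eq)
    then have "nrm (rdiag p q (h (Suc t))) \<le> nrm (rdiag p q (h t))"
      using nrm_rdiag_shrink_entry[OF c(1,2) p q, of "h t" t] by (simp only:)
    then show ?case using Suc by (rule order_trans)
  qed
  from this[of p] have "nrm (rdiag p q (h p)) \<le> nrm (rdiag p q g)" .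
  moreover have "rdiag p q (h p) = rdiag p q f" by (rule eq_matI) (auto simp: h_def)
  ultimately show ?thesis by simp
qed

text \<open>The singular values of \<open>B - X\<close> are those of \<open>B\<close> shifted by \<open>t\<close> and padded with zeros. By Weyl's inequality
  they are at most those of \<open>B - Y\<close>, and the norm is monotone in the singular values.\<close>

theorem mirsky:
  assumes B: "B \<in> kmats K p q" and Y: "Y \<in> kmats K p q" and r: "mrank Y \<le> t"
    and X: "truncated_svd K t B X" and p: "1 \<le> p" and q: "1 \<le> q"
  shows "X \<in> kmats K p q" and "nrm (B - X) \<le> nrm (B - Y)"
proof -
  let ?s = "\<lambda>i. sing_val B (Suc i)"
  have Bc: "B \<in> carrier_mat p q" using B by (rule kmats_carrier)
  obtain W V where svd: "svd K B W V" and Xe: "X = W * sigma_mat B t * adj V"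
    using X by (auto simp: truncated_svd_def)
  note W = svd_rdiag[OF svd Bc]
  note Wc = unitaryD[OF W(1)] and Vc = unitaryD[OF W(2)]
  have WV: "W \<in> kmats K p p" "V \<in> kmats K q q"
    using svd Bc by (auto simp: svd_def unitary_mats_def)
  have Xr: "X = W * rdiag p q (\<lambda>i. if i < t then ?s i else 0) * adj V"
    using Xe Bc by (simp add: sigma_mat_eq_rdiag)
  show XK: "X \<in> kmats K p q"
    unfolding Xr by (intro kmats_mult[of _ p q _ q] kmats_mult[of _ p p _ q] kmats_adj rdiag_kmats WV)
  \<comment> \<open>\<open>f\<close> and \<open>g\<close> list the singular values of \<open>B - X\<close>: in the order of the diagonal of \<open>W\<^sup>* (B - X) V\<close>, and in
    descending order.\<close>
  define f where "f i = (if i < t then 0 else ?s i)" for i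
  define g where "g i = ?s (i + t)" for i
  have "B - X = W * (rdiag p q ?s - rdiag p q (\<lambda>i. if i < t then ?s i else 0)) * adj V"
    unfolding Xr using Wc Vc
    by (subst W(3)) (simp add: mult_minus_distrib_mat' minus_mult_distrib_mat')
  also have "rdiag p q ?s - rdiag p q (\<lambda>i. if i < t then ?s i else 0) = rdiag p q f"
    by (rule eq_matI) (auto simp: f_def)
  finally have BX: "B - X = W * rdiag p q f * adj V" .
  have nonneg: "0 \<le> f i" "0 \<le> g i" for i by (auto simp: f_def g_def sing_val_nonneg)
  have fp: "(\<lambda>i. if i < p then f i else 0) = f" and gp: "(\<lambda>i. if i < p then g i else 0) = g"
    using sing_val_eq_0[of B] Bc by (auto simp: f_def g_def fun_eq_iff)
  have rf: "right_singular_basis (B - X) V f"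
    using right_singular_basis_rdiag[OF W(1,2), of f] nonneg(1) by (simp add: BX fp)
  have rg: "right_singular_basis (rdiag p q g) (1\<^sub>m q) g"
    using right_singular_basis_rdiag[OF unitary_one[of p] unitary_one[of q], of g] nonneg(2)
    by (simp add: gp left_mult_one_mat[OF rdiag_carrier(1)] right_mult_one_mat[OF rdiag_carrier(1)])
  have "mset (map f [0..<q]) = mset (map g [0..<q])"
  proof (cases "t \<le> q")
    case True
    have "map f [0..<q] = map f [0..<t] @ map f [t..<q]"
      using upt_add_eq_append[of 0 t "q - t"] True by simp
    moreover have "map f [0..<t] = replicate t 0"
      by (rule nth_equalityI) (auto simp: f_def)
    moreover have "map f [t..<q] = map ?s [t..<q]" by (auto simp: f_def)
    moreover have "map g [0..<q] = map g [0..<q - t] @ map g [q - t..<q]"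
      using upt_add_eq_append[of 0 "q - t" t] True by simp
    moreover have "map g [0..<q - t] = map ?s [t..<q]"
      using True by (intro nth_equalityI) (auto simp: g_def add.commute)
    moreover have "map g [q - t..<q] = replicate t 0"
      using True sing_val_eq_0[of B] Bc by (intro nth_equalityI) (auto simp: g_def)
    ultimately show ?thesis by simp
  next
    case False
    then have "map f [0..<q] = map g [0..<q]"
      using sing_val_eq_0[of B] Bc by (auto simp: f_def g_def)
    then show ?thesis by (simp only:)
  qed
  then have "sing_vals (B - X) = sing_vals (rdiag p q g)"
    using right_singular_basis_sing_mset[OF rf] right_singular_basis_sing_mset[OF rg] Bc
      kmats_carrier[OF XK]
    by (intro sing_vals_cong) auto
  then have "nrm (B - X) = nrm (rdiag p q g)"
    by (intro nrm_cong_sing_val[OF kmats_minus[OF B XK] p q rdiag_kmats p q]) (simp add: sing_val_def)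
  also have "\<dots> \<le> nrm (rdiag p q (\<lambda>i. sing_val (B - Y) (Suc i)))"
    using weyl_low_rank[OF Bc kmats_carrier[OF Y] r] nonneg
    by (intro nrm_rdiag_mono p q) (auto simp: g_def)
  also have "\<dots> = nrm (B - Y)"
    by (rule nrm_eq_nrm_rdiag[OF kmats_minus[OF B Y] p q, symmetric])
  finally show "nrm (B - X) \<le> nrm (B - Y)" .
qed

end

lemma truncated_svd_sing_val:
  assumes B: "B \<in> carrier_mat p q" and X: "truncated_svd K t B X"
  shows "sing_val X (Suc i) = (if i < t then sing_val B (Suc i) else 0)"
proof -
  obtain W V where svd: "svd K B W V" and Xe: "X = W * sigma_mat B t * adj V"
    using X by (auto simp: truncated_svd_def)
  note W = svd_rdiag[OF svd B]
  have "sing_val (W * rdiag p q (\<lambda>i. if i < t then sing_val B (Suc i) else 0) * adj V) (Suc i) =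
    (if i < p \<and> i < q then if i < t then sing_val B (Suc i) else 0 else 0)"
    by (rule sing_val_rdiag[OF W(1,2)]) (auto simp: sing_val_nonneg sing_val_antimono)
  then show ?thesis using Xe B sing_val_eq_0[of B i] by (auto simp: sigma_mat_eq_rdiag)
qed

text \<open>The truncated part \<open>B - X\<close> has row and column spaces orthogonal to those of \<open>X\<close>.\<close>

lemma truncated_svd_orthogonal:
  assumes B: "B \<in> carrier_mat p q" and X: "truncated_svd K t B X"
  shows "X \<in> carrier_mat p q" "adj X * B = adj X * X" "B * adj X = X * adj X"
proof -
  let ?s = "\<lambda>i. sing_val B (Suc i)" and ?st = "\<lambda>i. if i < t then sing_val B (Suc i) else 0"
  obtain W V where svd: "svd K B W V" and Xe: "X = W * sigma_mat B t * adj V"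
    using X by (auto simp: truncated_svd_def)
  note W = svd_rdiag[OF svd B]
  note Wc = unitaryD[OF W(1)] and Vc = unitaryD[OF W(2)]
  have Xr: "X = W * rdiag p q ?st * adj V" using Xe B by (simp add: sigma_mat_eq_rdiag)
  show "X \<in> carrier_mat p q" unfolding Xr using Wc Vc by (intro carrier_matI) auto
  have 1: "adj (rdiag p q ?st) * rdiag p q ?s = adj (rdiag p q ?st) * rdiag p q ?st"
    by (rule eq_matI)
       (auto simp: mult_index[OF adj_carrier[OF rdiag_carrier(1)] rdiag_carrier(1)]
         simp del: index_mult_mat(1) intro!: sum.cong)
  have 2: "rdiag p q ?s * adj (rdiag p q ?st) = rdiag p q ?st * adj (rdiag p q ?st)"
    by (rule eq_matI)
       (auto simp: mult_index[OF rdiag_carrier(1) adj_carrier[OF rdiag_carrier(1)]]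
         simp del: index_mult_mat(1) intro!: sum.cong)
  have "adj X * B = V * (adj (rdiag p q ?st) * rdiag p q ?s) * adj V"
    unfolding Xr using Wc Vc
    by (subst W(3)) (simp add: adj_mult' assoc_mult_mat' unitary_cancel[OF W(1)])
  also have "\<dots> = adj X * X"
    unfolding 1 unfolding Xr using Wc Vc by (simp add: adj_mult' assoc_mult_mat' unitary_cancel[OF W(1)])
  finally show "adj X * B = adj X * X" .
  have "B * adj X = W * (rdiag p q ?s * adj (rdiag p q ?st)) * adj W"
    unfolding Xr using Wc Vc
    by (subst W(3)) (simp add: adj_mult' assoc_mult_mat' unitary_cancel[OF W(2)])
  also have "\<dots> = X * adj X"
    unfolding 2 unfolding Xr using Wc Vc by (simp add: adj_mult' assoc_mult_mat' unitary_cancel[OF W(2)])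
  finally show "B * adj X = X * adj X" .
qed

section \<open>Perturbation of a product \<open>P U Q\<close>\<close>

text \<open>From \<open>X = X Y X\<close>, for \<open>X = Y\<^sup>\<dagger>\<close>, a factor \<open>Y\<^sup>*\<close> can be split off from \<open>X\<close> on either side, and \<open>B Y\<^sup>* = Y Y\<^sup>*\<close>,
  \<open>Y\<^sup>* B = Y\<^sup>* Y\<close>.\<close>

lemma pinv_truncated_svd:
  assumes B: "B \<in> carrier_mat p q" and Y: "truncated_svd K t B Y"
  shows "B * pinv Y = Y * pinv Y" "pinv Y * B = pinv Y * Y"
proof -
  note Yc = truncated_svd_orthogonal[OF B Y]
  note X = pinv_props[OF Yc(1)]
  let ?X = "pinv Y"
  have d: "dim_row Y = p" "dim_col Y = q" "dim_row ?X = q" "dim_col ?X = p" "dim_row B = p" "dim_col B = q"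
    using Yc(1) X(1) B by auto
  have X1: "?X = adj Y * (adj ?X * ?X)"
  proof -
    have "?X = adj (?X * Y) * ?X" by (simp only: X)
    also have "\<dots> = adj Y * (adj ?X * ?X)" using d by (simp add: adj_mult' assoc_mult_mat')
    finally show ?thesis .
  qed
  have X2: "?X = (?X * adj ?X) * adj Y"
  proof -
    have "?X = ?X * adj (Y * ?X)" using d by (simp only: X) (simp only: X assoc_mult_mat'[symmetric])
    also have "\<dots> = (?X * adj ?X) * adj Y" using d by (simp add: adj_mult' assoc_mult_mat')
    finally show ?thesis .
  qed
  have "B * ?X = B * (adj Y * (adj ?X * ?X))" using X1 by (rule arg_cong)
  also have "\<dots> = (B * adj Y) * (adj ?X * ?X)" using d by (simp add: assoc_mult_mat')
  also have "\<dots> = (Y * adj Y) * (adj ?X * ?X)" by (simp only: Yc(3))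
  also have "\<dots> = Y * (adj Y * (adj ?X * ?X))" using d by (simp add: assoc_mult_mat')
  also have "\<dots> = Y * ?X" by (simp only: X1[symmetric])
  finally show "B * ?X = Y * ?X" .
  have "?X * B = ((?X * adj ?X) * adj Y) * B" using X2 by (rule arg_cong)
  also have "\<dots> = (?X * adj ?X) * (adj Y * B)" using d by (simp add: assoc_mult_mat')
  also have "\<dots> = (?X * adj ?X) * (adj Y * Y)" by (simp only: Yc(2))
  also have "\<dots> = ((?X * adj ?X) * adj Y) * Y" using d by (simp add: assoc_mult_mat')
  also have "\<dots> = ?X * Y" by (simp only: X2[symmetric])
  finally show "?X * B = ?X * Y" .
qed

text \<open>The products \<open>U X\<close>, \<open>X U\<close> and \<open>U X U\<close> are expressed through the projections \<open>Y X\<close> and \<open>X Y\<close>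
  before norms are taken: a projection does not increase norms, which saves the factors that
  submultiplicativity would cost.\<close>

lemma skeleton_expansion:
  fixes P Q U E Y X B E1 E2 :: "complex mat"
  assumes P: "P \<in> carrier_mat m r" and Q: "Q \<in> carrier_mat s n" and U: "U \<in> carrier_mat r s"
    and E: "E \<in> carrier_mat r s" and B: "B = U + E" and Y: "Y \<in> carrier_mat r s" and X: "X \<in> carrier_mat s r"
    and E1: "E1 \<in> carrier_mat r n" and E2: "E2 \<in> carrier_mat m s"
    and BX: "B * X = Y * X" and XB: "X * B = X * Y" and YXY: "Y * X * Y = Y"
  shows "P * U * Q - (P * U + E2) * X * (U * Q + E1) =
    P * ((U - Y + Y * X * E) + (E * (X * Y) - E * X * E)) * Q - P * (Y * X * E1 - E * X * E1)
    - (E2 * (X * Y) - E2 * X * E) * Q - E2 * X * E1"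
proof -
  have d: "dim_row P = m" "dim_col P = r" "dim_row Q = s" "dim_col Q = n" "dim_row U = r" "dim_col U = s"
    "dim_row E = r" "dim_col E = s" "dim_row Y = r" "dim_col Y = s" "dim_row X = s" "dim_col X = r"
    "dim_row E1 = r" "dim_col E1 = n" "dim_row E2 = m" "dim_col E2 = s"
    using assms by auto
  have UB: "U = B - E" using B U E by (intro eq_matI) auto
  have dB: "dim_row B = r" "dim_col B = s" using B d by auto
  have UX: "U * X = Y * X - E * X"
    unfolding UB using d dB by (simp add: minus_mult_distrib_mat' BX)
  have XU: "X * U = X * Y - X * E"
    unfolding UB using d dB by (simp add: mult_minus_distrib_mat' XB)
  have UXU: "U * X * U = Y - Y * X * E - (E * (X * Y) - E * X * E)"
  proof -
    have "U * X * U = Y * (X * U) - E * (X * U)"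
      unfolding UX using d by (simp add: minus_mult_distrib_mat' assoc_mult_mat')
    also have "Y * (X * U) = Y - Y * X * E"
      unfolding XU using d by (simp add: mult_minus_distrib_mat' YXY flip: assoc_mult_mat')
    also have "E * (X * U) = E * (X * Y) - E * X * E"
      unfolding XU using d by (simp add: mult_minus_distrib_mat' assoc_mult_mat')
    finally show ?thesis .
  qed
  have split: "U - U * X * U = (U - Y + Y * X * E) + (E * (X * Y) - E * X * E)"
    unfolding UXU using d by (intro eq_matI) (simp_all del: index_mult_mat(1))
  have "(P * U + E2) * X * (U * Q + E1) =
    (P * (U * X * U) * Q + P * (U * X * E1)) + (E2 * (X * U) * Q + E2 * X * E1)"
    using d by (simp add: add_mult_distrib_mat' mult_add_distrib_mat' assoc_mult_mat')
      (intro eq_matI; simp del: index_mult_mat(1))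
  moreover have "P * (U - U * X * U) * Q = P * U * Q - P * (U * X * U) * Q"
    using d by (simp add: mult_minus_distrib_mat' minus_mult_distrib_mat')
  moreover have "U * X * E1 = Y * X * E1 - E * X * E1"
    unfolding UX using d by (simp add: minus_mult_distrib_mat')
  moreover have "E2 * (X * U) = E2 * (X * Y) - E2 * X * E"
    unfolding XU using d by (simp add: mult_minus_distrib_mat' assoc_mult_mat')
  ultimately have "P * U * Q - (P * U + E2) * X * (U * Q + E1) =
    P * (U - U * X * U) * Q - P * (Y * X * E1 - E * X * E1)
    - (E2 * (X * Y) - E2 * X * E) * Q - E2 * X * E1"
    using d by (simp only:) (intro eq_matI; simp del: index_mult_mat(1))
  then show ?thesis by (simp only: split)
qed

context ui_norm
begin

text \<open>The four summands of the expansion are bounded one by one. The coefficient 4 consists of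
  \<open>\<parallel>U - Y\<parallel> \<le> 2 \<parallel>E\<parallel>\<close> and one \<open>\<parallel>E\<parallel>\<close> for each of the products \<open>Y X E\<close> and \<open>E X Y\<close>.\<close>

theorem skeleton_perturbation:
  assumes P: "P \<in> kmats K m r" and Q: "Q \<in> kmats K s n" and U: "U \<in> kmats K r s" and E: "E \<in> kmats K r s"
    and E1: "E1 \<in> kmats K r n" and E2: "E2 \<in> kmats K m s"
    and Y: "truncated_svd K k (U + E) Y" and k: "mrank U \<le> k"
    and pos: "1 \<le> m" "1 \<le> n" "1 \<le> r" "1 \<le> s"
  shows "nrm (P * U * Q - (P * U + E2) * pinv Y * (U * Q + E1)) \<le>
    nrm P * nrm E1 + nrm Q * nrm E2 + 4 * nrm P * nrm Q * nrm E
    + nrm (pinv Y) * (nrm P * nrm E1 * nrm E + nrm Q * nrm E2 * nrm E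
      + nrm P * nrm Q * (nrm E)\<^sup>2 + nrm E1 * nrm E2)"
    and "nrm (U - Y) \<le> 2 * nrm E" and "Y \<in> kmats K r s"
proof -
  let ?X = "pinv Y" and ?B = "U + E"
  have B: "?B \<in> kmats K r s" by (rule kmats_add[OF U E])
  note M = mirsky[OF B U k Y pos(3,4)]
  note YK = M(1)
  note XK = kmats_pinv[OF YK]
  note c = P[THEN kmats_carrier] Q[THEN kmats_carrier] U[THEN kmats_carrier] E[THEN kmats_carrier]
    E1[THEN kmats_carrier] E2[THEN kmats_carrier] B[THEN kmats_carrier] YK[THEN kmats_carrier]
    XK[THEN kmats_carrier]
  note X = pinv_props[OF c(8)]
  note km = kmats_mult
  show "Y \<in> kmats K r s" by (rule YK)
  have "?B - U = E" using c by (intro eq_matI) auto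
  then have BY: "nrm (?B - Y) \<le> nrm E" using M(2) by simp
  have "U - Y = (?B - Y) - E" using c by (intro eq_matI) auto
  then show UY: "nrm (U - Y) \<le> 2 * nrm E"
    using nrm_minus_le[OF kmats_minus[OF B YK] E pos(3,4)] BY by simp
  have nn: "0 \<le> nrm P" "0 \<le> nrm Q" "0 \<le> nrm E" "0 \<le> nrm E1" "0 \<le> nrm E2" "0 \<le> nrm ?X"
    using nonneg[OF pos(1,3) P] nonneg[OF pos(4,2) Q] nonneg[OF pos(3,4) E] nonneg[OF pos(3,2) E1]
      nonneg[OF pos(1,4) E2] nonneg[OF pos(4,3) XK] by auto
  have YX: "Y * ?X \<in> kmats K r r" "Y * ?X * (Y * ?X) = Y * ?X"
    and XY: "?X * Y \<in> kmats K s s" "?X * Y * (?X * Y) = ?X * Y"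
  proof -
    show "Y * ?X \<in> kmats K r r" "?X * Y \<in> kmats K s s" by (rule km[OF YK XK], rule km[OF XK YK])
    have "Y * ?X * (Y * ?X) = (Y * ?X * Y) * ?X" using c by (simp add: assoc_mult_mat')
    then show "Y * ?X * (Y * ?X) = Y * ?X" by (simp only: X)
    have "?X * Y * (?X * Y) = (?X * Y * ?X) * Y" using c by (simp add: assoc_mult_mat')
    then show "?X * Y * (?X * Y) = ?X * Y" by (simp only: X)
  qed
  have EXE: "nrm (E * ?X * F) \<le> nrm E * nrm ?X * nrm F" if "F \<in> kmats K r l" "1 \<le> l" for F l
    using submultiplicative[OF pos(3,3) that(2) km[OF E XK] that(1)]
      mult_right_mono[OF submultiplicative[OF pos(3,4,3) E XK] nonneg[OF pos(3) that(2,1)]] by simp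
  have E2X: "nrm (E2 * ?X * F) \<le> nrm E2 * nrm ?X * nrm F" if "F \<in> kmats K r l" "1 \<le> l" for F l
    using submultiplicative[OF pos(1,3) that(2) km[OF E2 XK] that(1)]
      mult_right_mono[OF submultiplicative[OF pos(1,4,3) E2 XK] nonneg[OF pos(3) that(2,1)]] by simp
  have K1: "U - Y + Y * ?X * E \<in> kmats K r s" "E * (?X * Y) - E * ?X * E \<in> kmats K r s"
    by (rule kmats_add[OF kmats_minus[OF U YK] km[OF YX(1) E]],
        rule kmats_minus[OF km[OF E XY(1)] km[OF km[OF E XK] E]])
  let ?T1 = "(U - Y + Y * ?X * E) + (E * (?X * Y) - E * ?X * E)"
  let ?T2 = "Y * ?X * E1 - E * ?X * E1" and ?T3 = "E2 * (?X * Y) - E2 * ?X * E" and ?T4 = "E2 * ?X * E1"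
  have T1K: "?T1 \<in> kmats K r s" by (rule kmats_add[OF K1])
  have T1: "nrm ?T1 \<le> 4 * nrm E + nrm E * nrm ?X * nrm E"
  proof -
    have "nrm ?T1 \<le> nrm (U - Y + Y * ?X * E) + nrm (E * (?X * Y) - E * ?X * E)"
      by (rule triangle[OF pos(3,4) K1])
    also have "nrm (U - Y + Y * ?X * E) \<le> nrm (U - Y) + nrm (Y * ?X * E)"
      by (rule triangle[OF pos(3,4) kmats_minus[OF U YK] km[OF YX(1) E]])
    also have "nrm (E * (?X * Y) - E * ?X * E) \<le> nrm (E * (?X * Y)) + nrm (E * ?X * E)"
      by (rule nrm_minus_le[OF km[OF E XY(1)] km[OF km[OF E XK] E] pos(3,4)])
    finally show ?thesis
      using UY nrm_projection_mult_le[OF YX X(4) E pos(3,4)] nrm_mult_projection_le[OF XY X(5) E pos(3,4)]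
        EXE[OF E pos(4)] by linarith
  qed
  have T2K: "?T2 \<in> kmats K r n" by (rule kmats_minus[OF km[OF YX(1) E1] km[OF km[OF E XK] E1]])
  have T2: "nrm ?T2 \<le> nrm E1 + nrm E * nrm ?X * nrm E1"
    using nrm_minus_le[OF km[OF YX(1) E1] km[OF km[OF E XK] E1] pos(3,2)]
      nrm_projection_mult_le[OF YX X(4) E1 pos(3,2)] EXE[OF E1 pos(2)] by linarith
  have T3K: "?T3 \<in> kmats K m s" by (rule kmats_minus[OF km[OF E2 XY(1)] km[OF km[OF E2 XK] E]])
  have T3: "nrm ?T3 \<le> nrm E2 + nrm E2 * nrm ?X * nrm E"
    using nrm_minus_le[OF km[OF E2 XY(1)] km[OF km[OF E2 XK] E] pos(1,4)]
      nrm_mult_projection_le[OF XY X(5) E2 pos(1,4)] E2X[OF E pos(4)] by linarith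
  have T4K: "?T4 \<in> kmats K m n" by (rule km[OF km[OF E2 XK] E1])
  have T4: "nrm ?T4 \<le> nrm E2 * nrm ?X * nrm E1" by (rule E2X[OF E1 pos(2)])
  have S1K: "P * ?T1 * Q \<in> kmats K m n" by (rule km[OF km[OF P T1K] Q])
  have S1: "nrm (P * ?T1 * Q) \<le> nrm P * (4 * nrm E + nrm E * nrm ?X * nrm E) * nrm Q"
  proof -
    have "nrm (P * ?T1) \<le> nrm P * (4 * nrm E + nrm E * nrm ?X * nrm E)"
      using submultiplicative[OF pos(1,3,4) P T1K] mult_left_mono[OF T1 nn(1)] by linarith
    from mult_right_mono[OF this nn(2)] show ?thesis
      using submultiplicative[OF pos(1,4,2) km[OF P T1K] Q] by linarith
  qed
  have S2K: "P * ?T2 \<in> kmats K m n" by (rule km[OF P T2K])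
  have S2: "nrm (P * ?T2) \<le> nrm P * (nrm E1 + nrm E * nrm ?X * nrm E1)"
    using submultiplicative[OF pos(1,3,2) P T2K] mult_left_mono[OF T2 nn(1)] by linarith
  have S3K: "?T3 * Q \<in> kmats K m n" by (rule km[OF T3K Q])
  have S3: "nrm (?T3 * Q) \<le> (nrm E2 + nrm E2 * nrm ?X * nrm E) * nrm Q"
    using submultiplicative[OF pos(1,4,2) T3K Q] mult_right_mono[OF T3 nn(2)] by linarith
  have expansion: "P * U * Q - (P * U + E2) * ?X * (U * Q + E1) = P * ?T1 * Q - P * ?T2 - ?T3 * Q - ?T4"
    by (rule skeleton_expansion[OF c(1,2,3,4) refl c(8,9,5,6) pinv_truncated_svd[OF c(7) Y] X(2)])
  have "nrm (P * U * Q - (P * U + E2) * ?X * (U * Q + E1)) \<le>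
    nrm (P * ?T1 * Q) + nrm (P * ?T2) + nrm (?T3 * Q) + nrm ?T4"
    unfolding expansion
    using nrm_minus_le[OF kmats_minus[OF kmats_minus[OF S1K S2K] S3K] T4K pos(1,2)]
      nrm_minus_le[OF kmats_minus[OF S1K S2K] S3K pos(1,2)] nrm_minus_le[OF S1K S2K pos(1,2)] by linarith
  also have "\<dots> \<le> nrm P * (4 * nrm E + nrm E * nrm ?X * nrm E) * nrm Q
    + nrm P * (nrm E1 + nrm E * nrm ?X * nrm E1) + (nrm E2 + nrm E2 * nrm ?X * nrm E) * nrm Q
    + nrm E2 * nrm ?X * nrm E1"
    using S1 S2 S3 T4 by linarith
  also have "\<dots> = nrm P * nrm E1 + nrm Q * nrm E2 + 4 * nrm P * nrm Q * nrm E
    + nrm ?X * (nrm P * nrm E1 * nrm E + nrm Q * nrm E2 * nrm E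
      + nrm P * nrm Q * (nrm E)\<^sup>2 + nrm E1 * nrm E2)"
    by (simp add: algebra_simps power2_eq_square)
  finally show "nrm (P * U * Q - (P * U + E2) * ?X * (U * Q + E1)) \<le>
    nrm P * nrm E1 + nrm Q * nrm E2 + 4 * nrm P * nrm Q * nrm E
    + nrm ?X * (nrm P * nrm E1 * nrm E + nrm Q * nrm E2 * nrm E
      + nrm P * nrm Q * (nrm E)\<^sup>2 + nrm E1 * nrm E2)" .
qed

text \<open>If \<open>U + E\<close> had rank less than \<open>k\<close>, Weyl's inequality would give \<open>\<sigma>\<^sub>k(U) \<le> \<parallel>E\<parallel>\<^sub>2 \<le> \<parallel>E\<parallel>\<close>.\<close>

lemma mrank_truncated_svd_perturbed:
  assumes U: "U \<in> kmats K r s" and E: "E \<in> kmats K r s" and pos: "1 \<le> r" "1 \<le> s"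
    and k: "1 \<le> k" and gap: "nrm E < sing_val U k" and Y: "truncated_svd K k (U + E) Y"
  shows "mrank Y = k"
proof -
  note c = U[THEN kmats_carrier] E[THEN kmats_carrier]
  obtain l where l: "k = Suc l" using k by (cases k) auto
  have "\<not> mrank (U + E) \<le> l"
  proof
    assume "mrank (U + E) \<le> l"
    from weyl_low_rank[OF c(1) add_carrier_mat[OF c(2)] this, of 0]
    have "sing_val U k \<le> spectral_norm (U - (U + E))"
      by (simp add: l spectral_norm_def)
    also have "U - (U + E) = - E" using c by (intro eq_matI) auto
    also have "spectral_norm (- E) \<le> nrm (- E)"
      by (rule spectral_norm_le_nrm[OF kmats_uminus[OF E] pos])
    also have "\<dots> = nrm E" by (rule nrm_uminus[OF E pos])
    finally show False using gap by simp
  qed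
  then have "0 < sing_val (U + E) (Suc i)" if "i < k" for i
    using that l sing_val_pos_iff[of "U + E" i] by simp
  then have "{i. sing_val Y (Suc i) \<noteq> 0} = {..<k}"
    unfolding truncated_svd_sing_val[OF add_carrier_mat[OF c(2)] Y] by (auto split: if_splits) force
  then show ?thesis by (simp add: mrank_eq_card_sing_val)
qed

text \<open>The perturbation constant bounds \<open>\<parallel>Y\<^sup>\<dagger>\<parallel> - \<parallel>U\<^sup>\<dagger>\<parallel>\<close> by a multiple of \<open>\<parallel>Y\<^sup>\<dagger>\<parallel>\<^sub>2 \<le> \<parallel>Y\<^sup>\<dagger>\<parallel>\<close> itself, with a factor
  less than 1 by the gap condition.\<close>

lemma nrm_pinv_perturbed_le:
  assumes U: "U \<in> kmats K r s" and Y: "Y \<in> kmats K r s" and pos: "1 \<le> r" "1 \<le> s"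
    and rank: "mrank U = k" "mrank Y = k" and k: "1 \<le> k"
    and \<mu>: "pinv_perturbation_const K nrm \<mu>"
    and UY: "nrm (U - Y) \<le> 2 * \<epsilon>" and \<epsilon>: "0 \<le> \<epsilon>" and gap: "2 * \<mu> * \<epsilon> < sing_val U k"
  shows "0 < 1 - 2 * \<mu> * spectral_norm (pinv U) * \<epsilon>"
    and "nrm (pinv Y) \<le> nrm (pinv U) / (1 - 2 * \<mu> * spectral_norm (pinv U) * \<epsilon>)"
proof -
  let ?s = "spectral_norm (pinv U)"
  have \<mu>1: "1 \<le> \<mu>" using \<mu> by (simp add: pinv_perturbation_const_def)
  obtain l where l: "k = Suc l" using k by (cases k) auto
  have s0: "0 \<le> ?s" using sing_val_nonneg[of "pinv U" 0] by (simp add: spectral_norm_def)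
  have s1: "sing_val U k * ?s \<le> 1"
    using sing_val_mult_spectral_norm_pinv_le_1[OF kmats_carrier[OF U], of l] rank l by simp
  show pos1: "0 < 1 - 2 * \<mu> * ?s * \<epsilon>"
  proof (cases "?s = 0")
    case False
    then have "2 * \<mu> * \<epsilon> * ?s < sing_val U k * ?s" using gap s0 by (intro mult_strict_right_mono) auto
    then show ?thesis using s1 by (simp add: mult_ac)
  qed simp
  note XU = kmats_pinv[OF U] and XY = kmats_pinv[OF Y]
  have "nrm (Y - U) = nrm (U - Y)"
  proof -
    have "Y - U = - (U - Y)"
      using kmats_carrier[OF U] kmats_carrier[OF Y] by (intro eq_matI) auto
    then show ?thesis using nrm_uminus[OF kmats_minus[OF U Y] pos] by simp
  qed
  then have YU: "nrm (Y - U) \<le> 2 * \<epsilon>" using UY by simp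
  have "nrm (pinv U - pinv Y) \<le> \<mu> * spectral_norm (pinv Y) * ?s * nrm (Y - U)"
    using \<mu>[unfolded pinv_perturbation_const_def, THEN conjunct2, THEN conjunct2, rule_format, OF pos U Y]
    by (simp only: rank if_True refl)
  also have "\<dots> \<le> \<mu> * nrm (pinv Y) * ?s * (2 * \<epsilon>)"
  proof (rule mult_mono[OF _ YU])
    have "\<mu> * spectral_norm (pinv Y) \<le> \<mu> * nrm (pinv Y)"
      using spectral_norm_le_nrm[OF XY pos(2,1)] \<mu>1 by (intro mult_left_mono) auto
    then show "\<mu> * spectral_norm (pinv Y) * ?s \<le> \<mu> * nrm (pinv Y) * ?s"
      using s0 by (rule mult_right_mono)
    show "0 \<le> \<mu> * nrm (pinv Y) * ?s" using \<mu>1 s0 nonneg[OF pos(2,1) XY] by simp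
    show "0 \<le> nrm (Y - U)" by (rule nonneg[OF pos kmats_minus[OF Y U]])
  qed
  finally have diff: "nrm (pinv U - pinv Y) \<le> 2 * \<mu> * ?s * \<epsilon> * nrm (pinv Y)" by (simp add: mult_ac)
  have "pinv Y = pinv U - (pinv U - pinv Y)"
    using kmats_carrier[OF XU] kmats_carrier[OF XY] by (intro eq_matI) auto
  then have "nrm (pinv Y) \<le> nrm (pinv U) + nrm (pinv U - pinv Y)"
    using nrm_minus_le[OF XU kmats_minus[OF XU XY] pos(2,1)] by simp
  then have "nrm (pinv Y) * (1 - 2 * \<mu> * ?s * \<epsilon>) \<le> nrm (pinv U)"
    using diff by (simp add: algebra_simps)
  then show "nrm (pinv Y) \<le> nrm (pinv U) / (1 - 2 * \<mu> * ?s * \<epsilon>)"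
    using pos1 by (simp add: pos_le_divide_eq)
qed

end

section \<open>Submatrices\<close>

lemma submatrix_mult:
  assumes A: "A \<in> carrier_mat m r" and B: "B \<in> carrier_mat r n"
  shows "submatrix (A * B) I J = submatrix A I UNIV * submatrix (B :: complex mat) UNIV J"
proof (rule eq_matI)
  let ?p = "card {i. i < m \<and> i \<in> I}" and ?q = "card {j. j < n \<and> j \<in> J}"
  have sA: "submatrix A I UNIV \<in> carrier_mat ?p r" and sB: "submatrix B UNIV J \<in> carrier_mat r ?q"
    using A B by (auto simp: submatrix_def)
  fix i j assume "i < dim_row (submatrix A I UNIV * submatrix B UNIV J)"
    "j < dim_col (submatrix A I UNIV * submatrix B UNIV J)"
  then have ij: "i < ?p" "j < ?q" using sA sB by auto
  then have pick: "pick I i < m" "pick J j < n" by (auto intro: pick_le)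
  have "submatrix (A * B) I J $$ (i, j) = (A * B) $$ (pick I i, pick J j)"
    using A B ij by (intro submatrix_index) auto
  also have "\<dots> = (\<Sum>l<r. A $$ (pick I i, l) * B $$ (l, pick J j))"
    by (rule mult_index[OF A B pick])
  also have "\<dots> = (\<Sum>l<r. submatrix A I UNIV $$ (i, l) * submatrix B UNIV J $$ (l, j))"
    by (rule sum.cong) (use A B ij in \<open>auto simp: submatrix_index pick_UNIV\<close>)
  also have "\<dots> = (submatrix A I UNIV * submatrix B UNIV J) $$ (i, j)"
    by (rule mult_index[OF sA sB ij, symmetric])
  finally show "submatrix (A * B) I J $$ (i, j) = (submatrix A I UNIV * submatrix B UNIV J) $$ (i, j)" .
qed (auto simp: dim_submatrix)

lemma submatrix_add:
  assumes "A \<in> carrier_mat m n" "B \<in> carrier_mat m n"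
  shows "submatrix (A + B) I J = submatrix A I J + submatrix B I J"
  by (rule eq_matI) (use assms in \<open>auto simp: submatrix_def pick_le\<close>)

lemma submatrix_adj: "submatrix (adj A) I J = adj (submatrix A J I)"
  by (rule eq_matI) (auto simp: submatrix_def pick_le)

lemma submatrix_UNIV [simp]: "submatrix A UNIV UNIV = A"
  by (rule eq_matI) (auto simp: submatrix_def pick_UNIV)

section \<open>The error of a perturbed skeleton decomposition\<close>

theorem theorem4p6:
  fixes K :: "complex set"
    and nrm :: "complex mat \<Rightarrow> real"
    and \<mu> :: real
    and m n k :: nat
    and I J :: "nat set"
    and A E A' C R U C' R' U' E\<^sub>I E\<^sub>J E\<^sub>I\<^sub>J W S V W\<^sub>I V\<^sub>J U'\<^sub>k :: "complex mat"
  assumes "K = \<real> \<or> K = UNIV"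
    and "A \<in> kmats K m n" and "E \<in> kmats K m n" and "A' = A + E"
    and "k = mrank A" and "k \<ge> 1"
    and "I \<subseteq> {..<m}" and "J \<subseteq> {..<n}"
    and "C = submatrix A UNIV J" and "R = submatrix A I UNIV" and "U = submatrix A I J"
    and "C' = submatrix A' UNIV J" and "R' = submatrix A' I UNIV" and "U' = submatrix A' I J"
    and "E\<^sub>I = submatrix E I UNIV" and "E\<^sub>J = submatrix E UNIV J" and "E\<^sub>I\<^sub>J = submatrix E I J"
    and "mrank C = k" and "mrank U = k" and "mrank R = k"
    and "compact_svd K A W S V"
    and "W\<^sub>I = submatrix W I UNIV" and "V\<^sub>J = submatrix V J UNIV"
    and "uniform_norm K nrm"
    and "pinv_perturbation_const K nrm \<mu>"
    and "truncated_svd K k U' U'\<^sub>k"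
    and "sing_val U k > 2 * \<mu> * nrm E\<^sub>I\<^sub>J"
  shows "nrm (A - C' * pinv U'\<^sub>k * R') \<le>
      (nrm (pinv W\<^sub>I) * nrm E\<^sub>I + nrm (pinv V\<^sub>J) * nrm E\<^sub>J
        + 4 * nrm (pinv W\<^sub>I) * nrm (pinv V\<^sub>J) * nrm E\<^sub>I\<^sub>J)
      + nrm (pinv U) / (1 - 2 * \<mu> * spectral_norm (pinv U) * nrm E\<^sub>I\<^sub>J) *
        (nrm (pinv W\<^sub>I) * nrm E\<^sub>I * nrm E\<^sub>I\<^sub>J + nrm (pinv V\<^sub>J) * nrm E\<^sub>J * nrm E\<^sub>I\<^sub>J
          + nrm (pinv W\<^sub>I) * nrm (pinv V\<^sub>J) * (nrm E\<^sub>I\<^sub>J)\<^sup>2 + nrm E\<^sub>I * nrm E\<^sub>J)"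
proof -
  note K = assms(1) and A = assms(2) and E = assms(3)
  note k = assms(5,6) and svd = assms(21) and \<mu> = assms(25) and gap = assms(27)
  interpret uniform_norm K nrm by (rule assms(24))
  interpret ui_norm K nrm by unfold_locales (rule K)
  define r where "r = card {i. i < m \<and> i \<in> I}"
  define s where "s = card {j. j < n \<and> j \<in> J}"
  note Ac = kmats_carrier[OF A] and Ec = kmats_carrier[OF E]
  have dA: "dim_row A = m" "dim_col A = n" using Ac by auto
  have W: "W \<in> kmats K m k" "adj W * W = 1\<^sub>m k" and V: "V \<in> kmats K n k" "adj V * V = 1\<^sub>m k"
    and S: "S = mat_diag k (\<lambda>i. complex_of_real (sing_val A (Suc i)))" and WSV: "A = W * S * adj V"
    using svd unfolding compact_svd_def Let_def dA k(1)[symmetric] by blast+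
  have Sc: "S \<in> carrier_mat k k" by (simp add: S)
  have W\<^sub>I: "W\<^sub>I \<in> kmats K r k" and V\<^sub>J: "V\<^sub>J \<in> kmats K s k"
    unfolding assms(22,23) r_def s_def
    using kmats_submatrix[OF W(1), of I UNIV] kmats_submatrix[OF V(1), of J UNIV] by simp_all
  have U: "U \<in> kmats K r s" and E\<^sub>I\<^sub>J: "E\<^sub>I\<^sub>J \<in> kmats K r s"
    unfolding assms(11,17) r_def s_def by (rule kmats_submatrix[OF A], rule kmats_submatrix[OF E])
  have E\<^sub>I: "E\<^sub>I \<in> kmats K r n" and E\<^sub>J: "E\<^sub>J \<in> kmats K m s"
    unfolding assms(15,16) r_def s_def
    using kmats_submatrix[OF E, of I UNIV] kmats_submatrix[OF E, of UNIV J] by simp_all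
  note c = W(1)[THEN kmats_carrier] V(1)[THEN kmats_carrier] W\<^sub>I[THEN kmats_carrier] V\<^sub>J[THEN kmats_carrier]
    U[THEN kmats_carrier]
  have d: "dim_row W = m" "dim_col W = k" "dim_row V = n" "dim_col V = k" "dim_row W\<^sub>I = r" "dim_col W\<^sub>I = k"
    "dim_row V\<^sub>J = s" "dim_col V\<^sub>J = k" "dim_row S = k" "dim_col S = k"
    using c Sc by auto
  \<comment> \<open>The factorization \<open>A = W S V\<^sup>*\<close> restricts to the blocks \<open>C\<close>, \<open>R\<close> and \<open>U\<close>.\<close>
  have WS: "W * S \<in> carrier_mat m k" and aV: "adj V \<in> carrier_mat k n" using c Sc by auto
  have rows: "submatrix (W * S) I UNIV = W\<^sub>I * S"
    using submatrix_mult[OF c(1) Sc, of I UNIV] by (simp add: assms(22))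
  have cols: "submatrix (adj V) UNIV J = adj V\<^sub>J"
    by (simp add: submatrix_adj assms(23))
  have UWSV: "U = W\<^sub>I * S * adj V\<^sub>J"
    unfolding assms(11) WSV submatrix_mult[OF WS aV] rows cols ..
  have C: "C = W * S * adj V\<^sub>J"
    unfolding assms(9) WSV submatrix_mult[OF WS aV] cols by simp
  have R: "R = W\<^sub>I * S * adj V"
    unfolding assms(10) WSV submatrix_mult[OF WS aV] rows by simp
  have full: "mrank W\<^sub>I = k" "mrank V\<^sub>J = k"
  proof -
    have "U = W\<^sub>I * (S * adj V\<^sub>J)" using d by (simp add: UWSV assoc_mult_mat')
    moreover have "S * adj V\<^sub>J \<in> carrier_mat k s" using Sc c by simp
    ultimately have "k \<le> mrank W\<^sub>I" using mrank_mult_le_left[OF c(3)] assms(19) by metis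
    then show "mrank W\<^sub>I = k" using mrank_le_dim(2)[OF c(3)] by simp
    have "adj U = V\<^sub>J * (adj S * adj W\<^sub>I)" using d by (simp add: UWSV adj_mult' assoc_mult_mat')
    moreover have "adj S * adj W\<^sub>I \<in> carrier_mat k r"
      by (rule mult_carrier_mat[OF adj_carrier[OF Sc] adj_carrier[OF c(3)]])
    ultimately have "mrank (adj U) \<le> mrank V\<^sub>J" using mrank_mult_le_left[OF c(4)] by metis
    then show "mrank V\<^sub>J = k" using mrank_le_dim(2)[OF c(4)] assms(19) mrank_adj[of U] by simp
  qed
  \<comment> \<open>Full column rank makes \<open>F\<close> and \<open>H\<close> left inverses, so that \<open>P\<close> recovers all rows of \<open>A\<close> from those
    in \<open>I\<close>, and \<open>Q\<close> all columns from those in \<open>J\<close>.\<close>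
  define F where "F = pinv W\<^sub>I"
  define H where "H = pinv V\<^sub>J"
  have F: "F \<in> kmats K k r" "F * W\<^sub>I = 1\<^sub>m k" and H: "H \<in> kmats K k s" "H * V\<^sub>J = 1\<^sub>m k"
    unfolding F_def H_def
    by (rule kmats_pinv[OF W\<^sub>I], rule pinv_left_inverse[OF c(3) full(1)],
        rule kmats_pinv[OF V\<^sub>J], rule pinv_left_inverse[OF c(4) full(2)])
  have dFH: "dim_row F = k" "dim_col F = r" "dim_row H = k" "dim_col H = s"
    using F(1)[THEN kmats_carrier] H(1)[THEN kmats_carrier] by auto
  define P where "P = W * F"
  define Q where "Q = adj (V * H)"
  have P: "P \<in> kmats K m r" and Q: "Q \<in> kmats K s n"
    unfolding P_def Q_def by (rule kmats_mult[OF W(1) F(1)], rule kmats_adj[OF kmats_mult[OF V(1) H(1)]])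
  have PU: "P * U = C"
  proof -
    have "P * U = W * (F * W\<^sub>I) * S * adj V\<^sub>J"
      using d dFH by (simp add: P_def UWSV assoc_mult_mat')
    then show ?thesis using c by (simp add: F C)
  qed
  have HV: "adj V\<^sub>J * adj H = 1\<^sub>m k"
    using adj_mult'[of H V\<^sub>J] d dFH by (simp add: H)
  have UQ: "U * Q = R"
  proof -
    have "U * Q = W\<^sub>I * S * (adj V\<^sub>J * adj H) * adj V"
      using d dFH by (simp add: Q_def UWSV adj_mult' assoc_mult_mat')
    then show ?thesis unfolding HV R right_mult_one_mat[OF mult_carrier_mat[OF c(3) Sc]] .
  qed
  have PUQ: "P * U * Q = A"
  proof -
    have "P * U * Q = W * S * (adj V\<^sub>J * adj H) * adj V"
      unfolding PU C using d dFH by (simp add: Q_def adj_mult' assoc_mult_mat')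
    then show ?thesis unfolding HV WSV right_mult_one_mat[OF WS] .
  qed
  have perturbed: "U' = U + E\<^sub>I\<^sub>J" "C' = P * U + E\<^sub>J" "R' = U * Q + E\<^sub>I"
    unfolding PU UQ unfolding assms(4,9-17) by (rule submatrix_add[OF Ac Ec])+
  have pos: "1 \<le> m" "1 \<le> n" "1 \<le> r" "1 \<le> s"
    using mrank_le_dim[OF Ac] mrank_le_dim[OF c(5)] k assms(19) by auto
  have nP: "nrm P = nrm (pinv W\<^sub>I)"
    unfolding P_def F_def[symmetric] by (rule nrm_isometry[OF W F(1) pos(1,3) k(2)])
  have nQ: "nrm Q = nrm (pinv V\<^sub>J)"
  proof -
    have "nrm Q = nrm (V * H)"
      unfolding Q_def by (rule nrm_adj[OF kmats_mult[OF V(1) H(1)] pos(2,4)])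
    also have "\<dots> = nrm H" by (rule nrm_isometry[OF V H(1) pos(2,4) k(2)])
    finally show ?thesis unfolding H_def .
  qed
  have Y: "truncated_svd K k (U + E\<^sub>I\<^sub>J) U'\<^sub>k" using assms(26) by (simp only: perturbed)
  have rank: "mrank U \<le> k" using assms(19) by simp
  have nE: "0 \<le> nrm E\<^sub>I\<^sub>J" by (rule nonneg[OF pos(3,4) E\<^sub>I\<^sub>J])
  have "1 * nrm E\<^sub>I\<^sub>J \<le> 2 * \<mu> * nrm E\<^sub>I\<^sub>J"
    using \<mu> nE by (intro mult_right_mono) (auto simp: pinv_perturbation_const_def)
  then have gap': "nrm E\<^sub>I\<^sub>J < sing_val U k" using gap by simp
  note bound = skeleton_perturbation[OF P Q U E\<^sub>I\<^sub>J E\<^sub>I E\<^sub>J Y rank pos]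
  have rankY: "mrank U'\<^sub>k = k"
    by (rule mrank_truncated_svd_perturbed[OF U E\<^sub>I\<^sub>J pos(3,4) k(2) gap' Y])
  note pY = nrm_pinv_perturbed_le[OF U bound(3) pos(3,4) assms(19) rankY k(2) \<mu> bound(2) nE gap]
  let ?b = "nrm P * nrm E\<^sub>I * nrm E\<^sub>I\<^sub>J + nrm Q * nrm E\<^sub>J * nrm E\<^sub>I\<^sub>J
    + nrm P * nrm Q * (nrm E\<^sub>I\<^sub>J)\<^sup>2 + nrm E\<^sub>I * nrm E\<^sub>J"
  have "0 \<le> ?b"
    using nonneg[OF pos(1,3) P] nonneg[OF pos(4,2) Q] nE nonneg[OF pos(3,2) E\<^sub>I] nonneg[OF pos(1,4) E\<^sub>J]
    by simp
  then have le: "nrm (pinv U'\<^sub>k) * ?b \<le> nrm (pinv U) / (1 - 2 * \<mu> * spectral_norm (pinv U) * nrm E\<^sub>I\<^sub>J) * ?b"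
    using pY(2) by (rule mult_right_mono[rotated])
  have error: "A - C' * pinv U'\<^sub>k * R' = P * U * Q - (P * U + E\<^sub>J) * pinv U'\<^sub>k * (U * Q + E\<^sub>I)"
    unfolding PUQ perturbed(2,3) ..
  show ?thesis
    unfolding error using order_trans[OF bound(1) add_left_mono[OF le]] unfolding nP nQ .
qed

end
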